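(* Let $K$ be a non-archimedean local field and let $\Lambda$ be an open subgroup of finite index of $K^\times$. Let $d\ge1$ be an integer. Let $S$ be a closed subset of $K^d\times(K^d\setminus\{0\})$ which is $\Lambda$-conical in the second factor, i.e. $(x,\lambda\xi)\in S$ for all $(x,\xi)\in S$ and $\lambda\in\Lambda$. Then there is a distribution $u\in\mathcal{S}'(K^d)$ such that $\mathrm{WF}_\Lambda(u)=S$.
   Context: $K$ is a finite extension of $\mathbb{Q}_p$ or $\mathbb{F}_q((t))$, with valuation ring $\mathcal{O}_K$, maximal ideal $\mathcal{M}_K$ and valuation $\operatorname{ord}:K\to\mathbb{Z}\cup\{+\infty\}$. A fixed additive character $\psi_K:K\to\mathbb{C}^\times$ is trivial on $\mathcal{M}_K$ and nontrivial on $\mathcal{O}_K$. "Closed" means closed in $K^d\times(K^d\setminus\{0\})$. $\mathcal{S}(U)$ ($U\subset K^d$ open) is the space of locally constant compactly supported functions $U\to\mathbb{C}$; a distribution $u\in\mathcal{S}'(U)$ is a $\mathbb{C}$-linear map $\mathcal{S}(U)\to\mathbb{C}$. For $\varphi\in\mathcal{S}(U)$, $\mathcal{F}(\varphi u)$ is the locally constant function $\xi\mapsto\langle u,\varphi\,\psi_K(\cdot|\xi)\rangle$ on $K^d$, with $x|\xi=\sum_ix_i\xi_i$. The distribution $u$ is $\Lambda$-smooth at $(x_0,\xi_0)\in U\times(K^d\setminus\{0\})$ if there are open neighborhoods $U_0$ of $x_0$ and $V_0$ of $\xi_0$ such that for every $\varphi\in\mathcal{S}(U)$ with support in $U_0$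 there is an integer $N$ such that $\mathcal{F}(\varphi u)(\lambda\xi)=0$ for all $\lambda\in\Lambda$ with $\operatorname{ord}\lambda<N$ and all $\xi\in V_0$. $\mathrm{WF}_\Lambda(u)$ is the set of $(x_0,\xi_0)\in U\times(K^d\setminus\{0\})$ at which $u$ is not $\Lambda$-smooth. *)

theory Defs
  imports
    "HOL-Analysis.Analysis"
    "HOL-Computational_Algebra.Formal_Laurent_Series"
begin

section \<open>Non-archimedean local fields\<close>

text \<open>
  A valuation into the integers together with \<open>\<infinity>\<close> is represented by an integer-valued function
  which is only ever consulted at nonzero arguments; its value at \<open>0\<close> is irrelevant.
  The metric serves only to provide the valuation topology; the base \<open>2\<close> could be replaced by any
  real number greater than \<open>1\<close>.
\<close>

class discretely_valued_field = field + metric_space +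
  fixes ord_K :: "'a \<Rightarrow> int"
  assumes ord_K_mult: "x \<noteq> 0 \<Longrightarrow> y \<noteq> 0 \<Longrightarrow> ord_K (x * y) = ord_K x + ord_K y"
    and ord_K_add: "x \<noteq> 0 \<Longrightarrow> y \<noteq> 0 \<Longrightarrow> x + y \<noteq> 0 \<Longrightarrow> min (ord_K x) (ord_K y) \<le> ord_K (x + y)"
    and ord_K_normalized: "\<exists>x. x \<noteq> 0 \<and> ord_K x = 1"
    and dist_ord_K: "dist x y = (if x = y then 0 else 2 powi (- ord_K (x - y)))"

definition is_subfield :: "'a::field set \<Rightarrow> bool" where
  "is_subfield F \<longleftrightarrow> 1 \<in> F \<and>
     (\<forall>x\<in>F. \<forall>y\<in>F. x - y \<in> F \<and> x * y \<in> F) \<and> (\<forall>x\<in>F. inverse x \<in> F)"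

definition finite_extension_of :: "'a::field set \<Rightarrow> bool" where
  "finite_extension_of F \<longleftrightarrow> is_subfield F \<and>
     (\<exists>B. finite B \<and> (\<forall>x. \<exists>c. (\<forall>b\<in>B. c b \<in> F) \<and> x = (\<Sum>b\<in>B. c b * b)))"

text \<open>
  The subfield \<open>F\<close>, with the valuation it inherits, is the completion of the rational numbers for
  the \<open>p\<close>-adic valuation, i.e. the field of \<open>p\<close>-adic numbers. As the valuation of the ambient
  field is normalized there, it restricts to a positive multiple \<open>e\<close> (the ramification index) of
  the \<open>p\<close>-adic valuation. It suffices to prescribe it on nonzero integers, as it is
  multiplicative.
\<close>

definition is_padic_field :: "'k::discretely_valued_field set \<Rightarrow> nat \<Rightarrow> bool" where
  "is_padic_field F p \<longleftrightarrow> prime p \<and> is_subfield F \<and> complete F \<and>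
     F \<subseteq> closure {of_int a / of_int b | a b. b \<noteq> 0} \<and>
     (\<exists>e>0. \<forall>n::int. n \<noteq> 0 \<longrightarrow>
        (of_int n :: 'k) \<noteq> 0 \<and> ord_K (of_int n :: 'k) = e * int (multiplicity (int p) n))"

text \<open>
  The subfield \<open>F\<close> is isomorphic, as a valued field up to the factor \<open>e\<close>, to the field of formal
  Laurent series over a finite field \<open>k\<close>. Since \<open>F\<close> then contains a copy of \<open>k\<close>, one may take
  \<open>k\<close> to be a subfield of the ambient field, which avoids quantifying over a type.
\<close>

definition fls_over :: "'a::field set \<Rightarrow> 'a fls set" where
  "fls_over k = {f. \<forall>n. fls_nth f n \<in> k}"

definition is_laurent_series_field :: "'k::discretely_valued_field set \<Rightarrow> 'k set \<Rightarrow> bool" where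
  "is_laurent_series_field F k \<longleftrightarrow> finite k \<and> is_subfield k \<and>
     (\<exists>\<iota>. \<iota> 1 = 1 \<and>
        (\<forall>f\<in>fls_over k. \<forall>g\<in>fls_over k. \<iota> (f + g) = \<iota> f + \<iota> g \<and> \<iota> (f * g) = \<iota> f * \<iota> g) \<and>
        F = \<iota> ` fls_over k \<and>
        (\<exists>e>0. \<forall>f\<in>fls_over k. f \<noteq> 0 \<longrightarrow> \<iota> f \<noteq> 0 \<and> ord_K (\<iota> f) = e * fls_subdegree f))"

definition nonarch_local_field :: "'k::discretely_valued_field itself \<Rightarrow> bool" where
  "nonarch_local_field TYPE('k) \<longleftrightarrow>
     (\<exists>F :: 'k set. finite_extension_of F \<and>
        ((\<exists>p. is_padic_field F p) \<or> (\<exists>k. is_laurent_series_field F k)))"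

definition valuation_ring :: "'k::discretely_valued_field set" where
  "valuation_ring = {x. x = 0 \<or> ord_K x \<ge> 0}"

definition maximal_ideal :: "'k::discretely_valued_field set" where
  "maximal_ideal = {x. x = 0 \<or> ord_K x > 0}"

definition admissible_character :: "('k::discretely_valued_field \<Rightarrow> complex) \<Rightarrow> bool" where
  "admissible_character \<psi> \<longleftrightarrow>
     (\<forall>x. \<psi> x \<noteq> 0) \<and> (\<forall>x y. \<psi> (x + y) = \<psi> x * \<psi> y) \<and>
     (\<forall>x\<in>maximal_ideal. \<psi> x = 1) \<and> (\<exists>x\<in>valuation_ring. \<psi> x \<noteq> 1)"

text \<open>
  Openness in the multiplicative group is openness in the field, since the former is open in the
  latter.
\<close>

definition open_finite_index_subgroup :: "'k::discretely_valued_field set \<Rightarrow> bool" where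
  "open_finite_index_subgroup \<Lambda> \<longleftrightarrow>
     0 \<notin> \<Lambda> \<and> 1 \<in> \<Lambda> \<and> (\<forall>x\<in>\<Lambda>. \<forall>y\<in>\<Lambda>. x * y \<in> \<Lambda>) \<and> (\<forall>x\<in>\<Lambda>. inverse x \<in> \<Lambda>) \<and>
     open \<Lambda> \<and> finite {(\<lambda>x. c * x) ` \<Lambda> | c. c \<noteq> 0}"


section \<open>Distributions and wave front sets\<close>

definition supp :: "('a::topological_space \<Rightarrow> complex) \<Rightarrow> 'a set" where
  "supp \<phi> = closure {x. \<phi> x \<noteq> 0}"

text \<open>
  A test function on the open set \<open>U\<close> is represented by its extension by zero to the whole space.
  Accordingly a distribution on \<open>U\<close> is a functional of which only the values on such functions
  matter.
\<close>

definition test_functions :: "('k::discretely_valued_field ^ 'd) set \<Rightarrow> ('k ^ 'd \<Rightarrow> complex) set" where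
  "test_functions U = {\<phi>.
     (\<forall>x\<in>U. \<exists>V. open V \<and> x \<in> V \<and> V \<subseteq> U \<and> (\<forall>y\<in>V. \<phi> y = \<phi> x)) \<and>
     compact (supp \<phi>) \<and> supp \<phi> \<subseteq> U}"

definition distributions ::
  "('k::discretely_valued_field ^ 'd) set \<Rightarrow> (('k ^ 'd \<Rightarrow> complex) \<Rightarrow> complex) set" where
  "distributions U = {u.
     (\<forall>\<phi>\<in>test_functions U. \<forall>\<eta>\<in>test_functions U. u (\<lambda>x. \<phi> x + \<eta> x) = u \<phi> + u \<eta>) \<and>
     (\<forall>a. \<forall>\<phi>\<in>test_functions U. u (\<lambda>x. a * \<phi> x) = a * u \<phi>)}"

definition pairing :: "'k::discretely_valued_field ^ 'd \<Rightarrow> 'k ^ 'd \<Rightarrow> 'k" where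
  "pairing x \<xi> = (\<Sum>i\<in>UNIV. x $ i * \<xi> $ i)"

text \<open>\<open>fourier \<psi> \<phi> u\<close> is the Fourier transform of the compactly supported distribution \<open>\<phi>u\<close>.\<close>

definition fourier :: "('k::discretely_valued_field \<Rightarrow> complex) \<Rightarrow> ('k ^ 'd \<Rightarrow> complex) \<Rightarrow>
    (('k ^ 'd \<Rightarrow> complex) \<Rightarrow> complex) \<Rightarrow> 'k ^ 'd \<Rightarrow> complex" where
  "fourier \<psi> \<phi> u \<xi> = u (\<lambda>x. \<phi> x * \<psi> (pairing x \<xi>))"

definition smooth_at :: "('k::discretely_valued_field \<Rightarrow> complex) \<Rightarrow> 'k set \<Rightarrow> ('k ^ 'd) set \<Rightarrow>
    (('k ^ 'd \<Rightarrow> complex) \<Rightarrow> complex) \<Rightarrow> 'k ^ 'd \<Rightarrow> 'k ^ 'd \<Rightarrow> bool" where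
  "smooth_at \<psi> \<Lambda> U u x\<^sub>0 \<xi>\<^sub>0 \<longleftrightarrow>
     (\<exists>U\<^sub>0 V\<^sub>0. open U\<^sub>0 \<and> x\<^sub>0 \<in> U\<^sub>0 \<and> open V\<^sub>0 \<and> \<xi>\<^sub>0 \<in> V\<^sub>0 \<and>
        (\<forall>\<phi>\<in>test_functions U. supp \<phi> \<subseteq> U\<^sub>0 \<longrightarrow>
           (\<exists>N::int. \<forall>l\<in>\<Lambda>. ord_K l < N \<longrightarrow> (\<forall>\<xi>\<in>V\<^sub>0. fourier \<psi> \<phi> u (l *s \<xi>) = 0))))"

definition wave_front_set :: "('k::discretely_valued_field \<Rightarrow> complex) \<Rightarrow> 'k set \<Rightarrow> ('k ^ 'd) set \<Rightarrow>
    (('k ^ 'd \<Rightarrow> complex) \<Rightarrow> complex) \<Rightarrow> (('k ^ 'd) \<times> ('k ^ 'd)) set" where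
  "wave_front_set \<psi> \<Lambda> U u = {(x, \<xi>). x \<in> U \<and> \<xi> \<noteq> 0 \<and> \<not> smooth_at \<psi> \<Lambda> U u x \<xi>}"

end

theory Submission
  imports Defs "HOL-Number_Theory.Cong"
begin

text \<open>
  The distribution is a lacunary superposition of wave packets. A packet at scale \<open>n\<close> with position
  \<open>y\<close> and frequency \<open>\<eta>\<close> averages a test function over the coset \<open>y + lattice n\<close> against the character
  with frequency \<open>- \<eta>\<close>. By orthogonality of characters its Fourier transform is supported in
  \<open>\<eta> + lattice (1 - n)\<close>, as soon as the test function is constant on the coset
  (\<open>packet_eq_0_if_oscillating\<close>).

  The set \<open>S\<close> has a countable dense subset. Its points are enumerated, each infinitely often
  (\<open>dense_recurrent_sequence\<close>), and the direction of the \<open>n\<close>-th point is multiplied by an element of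
  \<open>\<Lambda>\<close> such that the frequencies \<open>\<eta> n\<close> grow fast: \<open>\<eta> n\<close> lies outside \<open>lattice (- 2 * n)\<close> and is
  larger than all its predecessors (\<open>lacunary_multipliers\<close>). As \<open>S\<close> is conical, the points
  \<open>(y n, \<eta> n)\<close> still belong to \<open>S\<close>. A test function is constant on the cosets of all but finitely
  many packets, and these packets vanish on it because of their oscillation, so that the sum of the
  packets defines a distribution.

  The width \<open>1 - n\<close> of the \<open>n\<close>-th packet in frequency space is negligible compared with the size of
  \<open>\<eta> n\<close>. Hence a packet contributes to the Fourier transform near \<open>x0\<close> at a large multiple of \<open>\<xi>0\<close>
  only if \<open>(y n, \<eta> n)\<close> is close to \<open>(x0, \<xi>0)\<close> up to a factor in \<open>\<Lambda>\<close>. As \<open>S\<close> is closed, this does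
  not occur at points outside \<open>S\<close> (\<open>packet_sum_smooth_off_closed_cone\<close>). At points of \<open>S\<close> it occurs
  infinitely often, and the packets cannot cancel since their frequencies have different sizes
  (\<open>packet_sum_not_smooth_at_limit\<close>).

  Two pieces of background carry this argument. Balls are compact
  (\<open>local_field_compact_fractional_ideal\<close>), because this holds in the base field and passes to
  finite-dimensional spaces over it; this provides test functions, countability and finite
  residue systems. The average over a lattice is constructed directly on locally constant functions by
  repeated averaging over residue classes (\<open>lattice_mean\<close>); what is used of it is linearity,
  normalization and translation invariance (\<open>mean_upto_translate\<close>).
\<close>

section \<open>The valuation topology\<close>

definition fractional_ideal :: "int \<Rightarrow> 'k::discretely_valued_field set" where
  "fractional_ideal k = {x. x = 0 \<or> k \<le> ord_K x}"

lemma ord_K_one [simp]: "ord_K (1::'k::discretely_valued_field) = 0"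
  using ord_K_mult[of "1::'k" 1] by simp

lemma ord_K_minus [simp]: "ord_K (- x) = ord_K (x::'k::discretely_valued_field)"
proof (cases "x = 0")
  case False
  have "ord_K (-1::'k) = 0"
    using ord_K_mult[of "-1::'k" "-1"] by simp
  then show ?thesis
    using ord_K_mult[of "-1" x] False by simp
qed simp

lemma ord_K_inverse:
  "x \<noteq> 0 \<Longrightarrow> ord_K (inverse x) = - ord_K (x::'k::discretely_valued_field)"
  using ord_K_mult[of x "inverse x"] by simp

lemma ord_K_power:
  "x \<noteq> 0 \<Longrightarrow> ord_K (x ^ n) = int n * ord_K (x::'k::discretely_valued_field)"
  by (induction n) (auto simp: ord_K_mult algebra_simps)

lemma fractional_ideal_0 [simp]: "0 \<in> fractional_ideal k"
  by (simp add: fractional_ideal_def)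

lemma fractional_ideal_add:
  "x \<in> fractional_ideal k \<Longrightarrow> y \<in> fractional_ideal k \<Longrightarrow> x + y \<in> fractional_ideal k"
  using ord_K_add[of x y]
  by (cases "x = 0"; cases "y = 0"; cases "x + y = 0") (auto simp: fractional_ideal_def)

lemma fractional_ideal_minus [simp]: "- x \<in> fractional_ideal k \<longleftrightarrow> x \<in> fractional_ideal k"
  by (auto simp: fractional_ideal_def)

lemma fractional_ideal_diff:
  "x \<in> fractional_ideal k \<Longrightarrow> y \<in> fractional_ideal k \<Longrightarrow> x - y \<in> fractional_ideal k"
  using fractional_ideal_add[of x k "- y"] by simp

lemma fractional_ideal_minus_commute:
  "x - y \<in> fractional_ideal k \<longleftrightarrow> y - x \<in> fractional_ideal k"
  using fractional_ideal_minus[of "x - y" k] by simp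

lemma fractional_ideal_sum:
  "(\<And>i. i \<in> I \<Longrightarrow> f i \<in> fractional_ideal k) \<Longrightarrow> (\<Sum>i\<in>I. f i) \<in> fractional_ideal k"
  by (induction I rule: infinite_finite_induct) (auto intro: fractional_ideal_add)

lemma fractional_ideal_antimono: "j \<le> k \<Longrightarrow> x \<in> fractional_ideal k \<Longrightarrow> x \<in> fractional_ideal j"
  by (auto simp: fractional_ideal_def)

lemma fractional_ideal_mult:
  "x \<in> fractional_ideal j \<Longrightarrow> y \<in> fractional_ideal k \<Longrightarrow> x * y \<in> fractional_ideal (j + k)"
  by (cases "x = 0 \<or> y = 0") (auto simp: fractional_ideal_def ord_K_mult)

lemma fractional_ideal_scale:
  "c \<noteq> 0 \<Longrightarrow> c * x \<in> fractional_ideal k \<longleftrightarrow> x \<in> fractional_ideal (k - ord_K c)"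
  by (cases "x = 0") (auto simp: fractional_ideal_def ord_K_mult)

lemma mem_some_fractional_ideal: "\<exists>k\<le>j. x \<in> fractional_ideal k"
  by (intro exI[of _ "min j (ord_K x)"]) (simp add: fractional_ideal_def)

lemma not_mem_some_fractional_ideal: "x \<noteq> 0 \<Longrightarrow> x \<notin> fractional_ideal (ord_K x + 1)"
  by (simp add: fractional_ideal_def)

lemma maximal_ideal_eq: "maximal_ideal = fractional_ideal 1"
  by (auto simp: maximal_ideal_def fractional_ideal_def)

lemma dist_le_iff_fractional_ideal:
  "dist x y \<le> 2 powi (- k) \<longleftrightarrow> x - y \<in> fractional_ideal k"
  using power_int_increasing[of "- ord_K (x - y)" "- k" "2::real"]
    power_int_strict_increasing[of "- k" "- ord_K (x - y)" "2::real"]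
  by (cases "k \<le> ord_K (x - y)") (auto simp: dist_ord_K fractional_ideal_def)

lemma fractional_ideal_eq_cball: "fractional_ideal k = cball 0 (2 powi (- k))"
proof (rule set_eqI)
  fix x :: 'a
  show "x \<in> fractional_ideal k \<longleftrightarrow> x \<in> cball 0 (2 powi (- k))"
    using dist_le_iff_fractional_ideal[of x 0 k] by (simp only: mem_cball diff_zero dist_commute)
qed

lemma powi_minus_less_ex:
  assumes "(e::real) > 0" shows "\<exists>k. (2::real) powi (- k) < e"
proof -
  obtain n where "(1/2::real) ^ n < e"
    using real_arch_pow_inv[OF assms, of "1/2"] by auto
  then have "(2::real) powi (- int n) < e"
    by (simp add: power_int_minus inverse_eq_divide power_one_over)
  then show ?thesis ..
qed

lemma eventually_nhds_fractional_ideal: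
  "eventually P (nhds x) \<longleftrightarrow> (\<exists>k. \<forall>y. y - x \<in> fractional_ideal k \<longrightarrow> P y)"
proof
  assume "eventually P (nhds x)"
  then obtain e where e: "e > 0" "\<And>y. dist y x < e \<Longrightarrow> P y"
    unfolding eventually_nhds_metric by blast
  obtain k where "(2::real) powi (- k) < e"
    using powi_minus_less_ex[OF e(1)] by blast
  then have "\<forall>y. y - x \<in> fractional_ideal k \<longrightarrow> P y"
    using e(2) dist_le_iff_fractional_ideal[of _ x k] by force
  then show "\<exists>k. \<forall>y. y - x \<in> fractional_ideal k \<longrightarrow> P y" ..
next
  assume "\<exists>k. \<forall>y. y - x \<in> fractional_ideal k \<longrightarrow> P y"
  then obtain k where "\<And>y. dist y x \<le> 2 powi (- k) \<Longrightarrow> P y"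
    by (auto simp: dist_le_iff_fractional_ideal)
  then have "\<forall>y. dist y x < 2 powi (- k) \<longrightarrow> P y"
    using less_imp_le by blast
  moreover have "(0::real) < 2 powi (- k)" by simp
  ultimately show "eventually P (nhds x)"
    unfolding eventually_nhds_metric by (intro exI[of _ "2 powi (- k)"] conjI)
qed

lemma tendsto_fractional_ideal_iff:
  "(f \<longlongrightarrow> l) F \<longleftrightarrow> (\<forall>k. \<forall>\<^sub>F y in F. f y - l \<in> fractional_ideal k)"
proof
  assume "(f \<longlongrightarrow> l) F"
  then show "\<forall>k. \<forall>\<^sub>F y in F. f y - l \<in> fractional_ideal k"
    using eventually_compose_filterlim[of "\<lambda>y. y - l \<in> fractional_ideal k" "nhds l" f F for k]
    by (meson eventually_nhds_fractional_ideal)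
next
  assume R: "\<forall>k. \<forall>\<^sub>F y in F. f y - l \<in> fractional_ideal k"
  show "(f \<longlongrightarrow> l) F"
    unfolding filterlim_iff eventually_nhds_fractional_ideal
  proof (intro allI impI)
    fix P assume "\<exists>k. \<forall>y. y - l \<in> fractional_ideal k \<longrightarrow> P y"
    then obtain k where k: "\<And>y. y - l \<in> fractional_ideal k \<Longrightarrow> P y" by blast
    show "\<forall>\<^sub>F x in F. P (f x)"
      using R[rule_format, of k] by eventually_elim (rule k)
  qed
qed

instance discretely_valued_field \<subseteq> topological_ab_group_add
proof
  fix a b :: "'a"
  show "((\<lambda>x. fst x + snd x) \<longlongrightarrow> a + b) (nhds a \<times>\<^sub>F nhds b)"
    unfolding tendsto_fractional_ideal_iff
  proof
    fix k
    have "\<forall>\<^sub>F x in nhds a \<times>\<^sub>F nhds b. fst x - a \<in> fractional_ideal k \<and> snd x - b \<in> fractional_ideal k"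
      by (rule eventually_prodI[of "\<lambda>x. x - a \<in> fractional_ideal k" _ "\<lambda>x. x - b \<in> fractional_ideal k"])
        (auto simp: eventually_nhds_fractional_ideal)
    then show "\<forall>\<^sub>F x in nhds a \<times>\<^sub>F nhds b. fst x + snd x - (a + b) \<in> fractional_ideal k"
    proof eventually_elim
      case (elim x)
      have "fst x + snd x - (a + b) = (fst x - a) + (snd x - b)"
        by simp
      then show ?case
        using elim fractional_ideal_add by metis
    qed
  qed
  show "(uminus \<longlongrightarrow> - a) (nhds a)"
    unfolding tendsto_fractional_ideal_iff eventually_nhds_fractional_ideal
    using fractional_ideal_minus_commute by (auto simp: algebra_simps)
qed

instance discretely_valued_field \<subseteq> topological_semigroup_mult
proof
  fix a b :: "'a"
  show "((\<lambda>x. fst x * snd x) \<longlongrightarrow> a * b) (nhds a \<times>\<^sub>F nhds b)"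
    unfolding tendsto_fractional_ideal_iff
  proof
    fix k
    obtain s where s: "s \<le> 0" "a \<in> fractional_ideal s"
      using mem_some_fractional_ideal by blast
    obtain t where t: "t \<le> 0" "b \<in> fractional_ideal t"
      using mem_some_fractional_ideal by blast
    define j where "j = \<bar>k\<bar> - s - t"
    have "\<forall>\<^sub>F x in nhds a \<times>\<^sub>F nhds b. fst x - a \<in> fractional_ideal j \<and> snd x - b \<in> fractional_ideal j"
      by (rule eventually_prodI[of "\<lambda>x. x - a \<in> fractional_ideal j" _ "\<lambda>x. x - b \<in> fractional_ideal j"])
        (auto simp: eventually_nhds_fractional_ideal)
    then show "\<forall>\<^sub>F x in nhds a \<times>\<^sub>F nhds b. fst x * snd x - a * b \<in> fractional_ideal k"
    proof eventually_elim
      case (elim x)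
      have j: "k \<le> j + j" "k \<le> s + j" "k \<le> j + t"
        using s t by (auto simp: j_def)
      have 1: "(fst x - a) * (snd x - b) \<in> fractional_ideal k"
        by (rule fractional_ideal_antimono[OF j(1) fractional_ideal_mult]) (use elim in auto)
      have 2: "a * (snd x - b) \<in> fractional_ideal k"
        by (rule fractional_ideal_antimono[OF j(2) fractional_ideal_mult]) (use elim s in auto)
      have 3: "(fst x - a) * b \<in> fractional_ideal k"
        by (rule fractional_ideal_antimono[OF j(3) fractional_ideal_mult]) (use elim t in auto)
      have "fst x * snd x - a * b = (fst x - a) * (snd x - b) + a * (snd x - b) + (fst x - a) * b"
        by (simp add: algebra_simps)
      then show ?case
        using 1 2 3 fractional_ideal_add by metis
    qed
  qed
qed

section \<open>Local compactness\<close>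

lemma closed_fractional_ideal: "closed (fractional_ideal k :: 'k::discretely_valued_field set)"
  by (simp add: fractional_ideal_eq_cball)

lemma subfield_closed:
  assumes "is_subfield F"
  shows "0 \<in> F" "1 \<in> F" "x \<in> F \<Longrightarrow> y \<in> F \<Longrightarrow> x + y \<in> F" "x \<in> F \<Longrightarrow> y \<in> F \<Longrightarrow> x - y \<in> F"
    "x \<in> F \<Longrightarrow> y \<in> F \<Longrightarrow> x * y \<in> F" "x \<in> F \<Longrightarrow> inverse x \<in> F" "x \<in> F \<Longrightarrow> - x \<in> F"
proof -
  have D: "x - y \<in> F" if "x \<in> F" "y \<in> F" for x y
    using assms that by (auto simp: is_subfield_def)
  show one: "1 \<in> F" using assms by (auto simp: is_subfield_def)
  show zero: "0 \<in> F" using D[OF one one] by simp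
  have M: "- x \<in> F" if "x \<in> F" for x
    using D[OF zero that] by simp
  show "x \<in> F \<Longrightarrow> y \<in> F \<Longrightarrow> x + y \<in> F" using D[of x "- y"] M[of y] by simp
qed (use assms in \<open>auto simp: is_subfield_def\<close>, metis cancel_comm_monoid_add_class.diff_cancel diff_0)

lemma subfield_of_int: "is_subfield F \<Longrightarrow> of_int n \<in> F"
proof (induction n rule: int_induct[where k = 0])
  case base then show ?case by (simp add: subfield_closed)
next
  case (step1 i) then show ?case by (simp add: subfield_closed)
next
  case (step2 i) then show ?case by (simp add: subfield_closed)
qed

text \<open>
  Completeness plus total boundedness gives compactness. The fractional ideals are exactly the closed
  balls around zero, so nets may be tested on residue classes instead of metric balls.
\<close>

lemma compact_if_fractional_ideal_nets:
  fixes X :: "'k::discretely_valued_field set"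
  assumes "complete X" and net: "\<And>m. \<exists>T. finite T \<and> (\<forall>x\<in>X. \<exists>t\<in>T. x - t \<in> fractional_ideal (int m))"
  shows "compact X"
  unfolding compact_eq_totally_bounded
proof (intro conjI allI impI)
  show "complete X" by fact
  fix e :: real assume "e > 0"
  then obtain k where k: "(2::real) powi (- k) < e"
    using powi_minus_less_ex by blast
  obtain T where T: "finite T" "\<forall>x\<in>X. \<exists>t\<in>T. x - t \<in> fractional_ideal (int (nat k))"
    using net by blast
  have "X \<subseteq> (\<Union>x\<in>T. ball x e)"
  proof
    fix x assume "x \<in> X"
    then obtain t where "t \<in> T" "x - t \<in> fractional_ideal (int (nat k))" using T by blast
    then have "x - t \<in> fractional_ideal k"
      by (intro fractional_ideal_antimono[of k "int (nat k)"]) auto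
    then have "dist x t < e" using k dist_le_iff_fractional_ideal[of x t k] by linarith
    then show "x \<in> (\<Union>x\<in>T. ball x e)" using \<open>t \<in> T\<close> by (auto simp: dist_commute)
  qed
  then show "\<exists>k. finite k \<and> X \<subseteq> (\<Union>x\<in>k. ball x e)" using T by blast
qed

text \<open>
  A unit denominator is invertible modulo every power of \<open>p\<close>, hence every \<open>p\<close>-integral rational is
  congruent modulo \<open>p ^ m\<close> to one of the integers \<open>0, \<dots>, p ^ m - 1\<close>. By density of the rationals these
  integers form a finite net of the integral part of the field, which is complete.
  The element of positive valuation serves to rescale this compact set to balls of any radius.
\<close>

lemma padic_field_compact:
  fixes F :: "'k::discretely_valued_field set"
  assumes "is_padic_field F p"
  shows "compact (F \<inter> fractional_ideal 0)" "\<exists>c\<in>F. c \<noteq> 0 \<and> ord_K c > 0"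
proof -
  have pF: "prime p" "is_subfield F" "complete F"
    and dense: "F \<subseteq> closure {of_int a / of_int b | a b. b \<noteq> 0}"
    using assms by (auto simp: is_padic_field_def)
  obtain e where e: "e > 0" and ord: "\<And>n::int. n \<noteq> 0 \<Longrightarrow>
        (of_int n :: 'k) \<noteq> 0 \<and> ord_K (of_int n :: 'k) = e * int (multiplicity (int p) n)"
    using assms by (auto simp: is_padic_field_def)
  have pp: "prime (int p)" using pF by simp
  have not_p: "\<not> is_unit (int p)" using pp not_prime_unit by blast
  have ordp: "ord_K (of_int (int p) :: 'k) = e" "of_int (int p) \<noteq> (0::'k)"
    using ord[of "int p"] pp by (auto simp: prime_gt_0_nat)
  then show "\<exists>c\<in>F. c \<noteq> 0 \<and> ord_K c > 0"
    using e subfield_of_int[OF pF(2)] by metis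
  have pow: "of_int n \<in> (fractional_ideal (int m) :: 'k set)" if "int p ^ m dvd n" for n m
  proof (cases "n = 0")
    case False
    then have "int m \<le> int (multiplicity (int p) n)"
      using that False multiplicity_geI[OF False not_p, of m] by simp
    also have "\<dots> \<le> e * int (multiplicity (int p) n)" using e by (simp add: mult_le_cancel_right1)
    finally show ?thesis using ord[OF False] by (simp add: fractional_ideal_def)
  qed simp
  show "compact (F \<inter> fractional_ideal 0)"
  proof (rule compact_if_fractional_ideal_nets)
    show "complete (F \<inter> fractional_ideal 0)"
      by (rule complete_Int_closed[OF \<open>complete F\<close> closed_fractional_ideal])
    fix m :: nat
    define T where "T = (of_int :: int \<Rightarrow> 'k) ` {0..<int p ^ m}"
    have "\<exists>t\<in>T. x - t \<in> fractional_ideal (int m)" if x: "x \<in> F" "x \<in> fractional_ideal 0" for x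
    proof -
      have "x \<in> closure {of_int a / of_int b | a b. b \<noteq> 0}" using dense x by blast
      then obtain a b where ab: "b \<noteq> 0" "dist (of_int a / of_int b) x \<le> 2 powi (- int m)"
        unfolding closure_approachable_le
        by (auto dest!: spec[of _ "2 powi (- int m)"])
      then have near: "of_int a / of_int b - x \<in> fractional_ideal (int m)"
        by (simp add: dist_le_iff_fractional_ideal)
      then have q: "(of_int a / of_int b :: 'k) \<in> fractional_ideal 0"
        using fractional_ideal_add[OF fractional_ideal_antimono[OF _ near, of 0] x(2)] by simp
      have "\<exists>c. (of_int a / of_int b :: 'k) - of_int c \<in> fractional_ideal (int m)"
      proof (cases "a = 0")
        case True
        then show ?thesis by (intro exI[of _ 0]) simp
      next
        case False
        define i where "i = multiplicity (int p) b"
        obtain b' where b': "b = int p ^ i * b'" "\<not> int p dvd b'"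
          using multiplicity_decompose'[OF ab(1) not_p] unfolding i_def by blast
        have "ord_K (of_int a / of_int b :: 'k) = ord_K (of_int a :: 'k) - ord_K (of_int b :: 'k)"
          using ord[OF False] ord[OF ab(1)]
          by (simp add: divide_inverse ord_K_mult ord_K_inverse)
        also have "\<dots> = e * (int (multiplicity (int p) a) - int i)"
          using ord[OF False] ord[OF ab(1)] by (simp add: i_def algebra_simps)
        finally have "0 \<le> e * (int (multiplicity (int p) a) - int i)"
          using q ord[OF False] ord[OF ab(1)] by (auto simp: fractional_ideal_def)
        then have "i \<le> multiplicity (int p) a"
          using e by (simp add: zero_le_mult_iff)
        then have "int p ^ i dvd a" by (rule multiplicity_dvd')
        then obtain a' where a': "a = int p ^ i * a'" by blast
        have b'0: "b' \<noteq> 0" using b' by auto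
        have "of_int a / of_int b = (of_int a' / of_int b' :: 'k)"
          using ordp by (simp add: a' b'(1))
        moreover have "coprime b' (int p ^ m)"
          using b'(2) pp by (metis coprime_commute coprime_power_right_iff prime_imp_coprime)
        then obtain s where "[b' * s = 1] (mod (int p ^ m))"
          using cong_solve_coprime_int by blast
        then have "int p ^ m dvd b' * s - 1"
          by (simp add: cong_iff_dvd_diff)
        then have "int p ^ m dvd (b' * s - 1) * a'" by simp
        then have "of_int ((b' * s - 1) * a') \<in> (fractional_ideal (int m) :: 'k set)" by (rule pow)
        moreover have "ord_K (of_int b' :: 'k) = 0" "(of_int b' :: 'k) \<noteq> 0"
          using ord[OF b'0] b'(2) by (auto simp: not_dvd_imp_multiplicity_0)
        ultimately have "of_int a / of_int b - of_int (s * a') \<in> (fractional_ideal (int m) :: 'k set)"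
          using fractional_ideal_scale[of "of_int b' :: 'k" "of_int a / of_int b - of_int (s * a')" "int m"]
            fractional_ideal_minus[of "of_int ((b' * s - 1) * a') :: 'k" "int m"]
          by (simp add: algebra_simps)
        then show ?thesis ..
      qed
      then obtain c where c: "(of_int a / of_int b :: 'k) - of_int c \<in> fractional_ideal (int m)" ..
      have "int p ^ m dvd c - c mod int p ^ m" by (simp add: minus_mod_eq_mult_div)
      then have c': "(of_int c - of_int (c mod int p ^ m) :: 'k) \<in> fractional_ideal (int m)"
        using pow by fastforce
      have "(of_int (c mod int p ^ m) :: 'k) \<in> T"
        using pp by (auto simp: T_def prime_gt_0_nat)
      moreover have "x - of_int (c mod int p ^ m) \<in> fractional_ideal (int m)"
        using fractional_ideal_add[OF fractional_ideal_diff[OF c near] c'] by simp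
      ultimately show ?thesis by blast
    qed
    moreover have "finite T" by (simp add: T_def)
    ultimately show "\<exists>T. finite T \<and> (\<forall>x\<in>F \<inter> fractional_ideal 0. \<exists>t\<in>T. x - t \<in> fractional_ideal (int m))"
      by blast
  qed
qed

lemma compact_PiE_euclidean:
  fixes A :: "'i \<Rightarrow> 'a::topological_space set"
  assumes "\<And>i. compact (A i)"
  shows "compact (Pi UNIV A)"
proof -
  have "compactin (product_topology (\<lambda>i. euclidean) UNIV) (PiE UNIV A)"
    using assms by (subst compactin_PiE) auto
  then show ?thesis
    by (simp add: euclidean_product_topology PiE_UNIV_domain)
qed

text \<open>
  The power series over the finite field \<open>k\<close> are the sequences of coefficients, a product of finite
  spaces and thus compact. Summation of the series is continuous: sequences that agree in the first
  \<open>j\<close> places have sums whose difference has valuation at least \<open>j\<close>.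
\<close>

lemma laurent_series_field_compact:
  fixes F :: "'k::discretely_valued_field set"
  assumes "is_laurent_series_field F k"
  shows "compact (F \<inter> fractional_ideal 0)" "\<exists>c\<in>F. c \<noteq> 0 \<and> ord_K c > 0"
proof -
  have k: "finite k" "is_subfield k"
    using assms by (auto simp: is_laurent_series_field_def)
  obtain \<iota> :: "'k fls \<Rightarrow> 'k" and e where add: "\<And>f g. f \<in> fls_over k \<Longrightarrow> g \<in> fls_over k \<Longrightarrow> \<iota> (f + g) = \<iota> f + \<iota> g"
    and F: "F = \<iota> ` fls_over k" and e: "e > 0"
    and ord: "\<And>f. f \<in> fls_over k \<Longrightarrow> f \<noteq> 0 \<Longrightarrow> \<iota> f \<noteq> 0 \<and> ord_K (\<iota> f) = e * fls_subdegree f"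
    using assms unfolding is_laurent_series_field_def by blast
  have "fls_X \<in> fls_over k"
    using k by (auto simp: fls_over_def subfield_closed)
  then show "\<exists>c\<in>F. c \<noteq> 0 \<and> ord_K c > 0"
    using ord[of fls_X] e F by auto
  have "0 \<in> fls_over k"
    using k by (simp add: fls_over_def subfield_closed)
  then have "\<iota> (0 + 0) = \<iota> 0 + \<iota> 0" by (intro add)
  then have zero: "\<iota> 0 = 0" by (metis add.right_neutral add_left_cancel)
  define series where "series a = fps_to_fls (Abs_fps a)" for a :: "nat \<Rightarrow> 'k"
  have series: "series a \<in> fls_over k" if "a \<in> Pi UNIV (\<lambda>_. k)" for a
    using that k by (auto simp: series_def fls_over_def subfield_closed)
  have image: "F \<inter> fractional_ideal 0 = (\<lambda>a. \<iota> (series a)) ` Pi UNIV (\<lambda>_. k)"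
  proof (intro subset_antisym subsetI)
    fix x assume "x \<in> F \<inter> fractional_ideal 0"
    then obtain f where f: "f \<in> fls_over k" "x = \<iota> f" "\<iota> f \<in> fractional_ideal 0"
      using F by blast
    have "fls_subdegree f \<ge> 0"
      using f ord[of f] e by (cases "f = 0") (auto simp: fractional_ideal_def zero_le_mult_iff)
    then have "series (\<lambda>n. fls_nth f (int n)) = f"
      unfolding series_def by (intro fls_eqI) auto
    moreover have "(\<lambda>n. fls_nth f (int n)) \<in> Pi UNIV (\<lambda>_. k)"
      using f by (auto simp: fls_over_def)
    ultimately show "x \<in> (\<lambda>a. \<iota> (series a)) ` Pi UNIV (\<lambda>_. k)"
      using f by force
  next
    fix x assume "x \<in> (\<lambda>a. \<iota> (series a)) ` Pi UNIV (\<lambda>_. k)"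
    then obtain a where a: "a \<in> Pi UNIV (\<lambda>_. k)" "x = \<iota> (series a)" by blast
    have "x \<in> fractional_ideal 0"
      using a zero ord[OF series[OF a(1)]] e
      by (cases "series a = 0") (auto simp: fractional_ideal_def series_def fls_subdegree_fls_to_fps_gt0)
    then show "x \<in> F \<inter> fractional_ideal 0"
      using a series F by blast
  qed
  have "continuous_on (Pi UNIV (\<lambda>_. k)) (\<lambda>a. \<iota> (series a))"
    unfolding continuous_on_def tendsto_fractional_ideal_iff
  proof (intro ballI allI)
    fix a j assume a: "a \<in> Pi UNIV (\<lambda>_::nat. k)"
    let ?F = "at a within Pi UNIV (\<lambda>_. k)"
    have in_k: "\<forall>\<^sub>F b in ?F. b \<in> Pi UNIV (\<lambda>_. k)"
      by (simp add: eventually_at_topological) blast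
    \<comment> \<open>A finite set of coefficients is discrete, so convergent coefficients are eventually constant.\<close>
    have coord: "\<forall>\<^sub>F b in ?F. b i = a i" for i
    proof -
      have "((\<lambda>b. b i) \<longlongrightarrow> a i) ?F"
        using continuous_on_product_coordinates continuous_on_def by (metis UNIV_I tendsto_within_subset subset_UNIV)
      moreover have "open (- (k - {a i}))"
        using k by (intro open_Compl finite_imp_closed) auto
      ultimately have "\<forall>\<^sub>F b in ?F. b i \<in> - (k - {a i})"
        by (rule topological_tendstoD) auto
      with in_k show ?thesis by eventually_elim auto
    qed
    then have "\<forall>\<^sub>F b in ?F. \<forall>i\<in>{..<nat j}. b i = a i"
      by (intro eventually_ball_finite) auto
    with in_k show "\<forall>\<^sub>F b in ?F. \<iota> (series b) - \<iota> (series a) \<in> fractional_ideal j"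
    proof eventually_elim
      case (elim b)
      define f where "f = series b - series a"
      have f: "f \<in> fls_over k"
        using series[OF a] series[OF elim(1)] k by (auto simp: f_def fls_over_def subfield_closed)
      have "\<iota> (f + series a) = \<iota> f + \<iota> (series a)"
        by (rule add[OF f series[OF a]])
      then have "\<iota> (series b) - \<iota> (series a) = \<iota> f" by (simp add: f_def)
      moreover have "\<iota> f \<in> fractional_ideal j"
      proof (cases "f = 0")
        case True
        then show ?thesis using zero by simp
      next
        case False
        have "fls_nth f i = 0" if "i < int (nat j)" for i
        proof (cases "i < 0")
          case False
          then have "nat i \<in> {..<nat j}" using that by (auto split: if_splits)
          then show ?thesis using elim(2) False by (simp add: f_def series_def)
        qed (simp add: f_def series_def)
        then have "fls_subdegree f \<ge> int (nat j)"
          using False by (intro fls_subdegree_geI) auto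
        moreover have "fls_subdegree f \<le> e * fls_subdegree f"
        proof -
          have "0 \<le> fls_subdegree f" using calculation by linarith
          then show ?thesis using mult_right_mono[of 1 e "fls_subdegree f"] e by simp
        qed
        ultimately have "j \<le> e * fls_subdegree f" by linarith
        then show ?thesis using ord[OF f False] by (auto simp: fractional_ideal_def)
      qed
      ultimately show ?case by simp
    qed
  qed
  then show "compact (F \<inter> fractional_ideal 0)"
    unfolding image using k by (intro compact_continuous_image compact_PiE_euclidean finite_imp_compact) auto
qed

lemma open_iff_fractional_ideal:
  "open U \<longleftrightarrow> (\<forall>x\<in>U. \<exists>k. \<forall>y. y - x \<in> fractional_ideal k \<longrightarrow> y \<in> U)"
proof
  assume "open U"
  then have "\<forall>\<^sub>F y in nhds x. y \<in> U" if "x \<in> U" for x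
    using that by (rule eventually_nhds_in_open)
  then show "\<forall>x\<in>U. \<exists>k. \<forall>y. y - x \<in> fractional_ideal k \<longrightarrow> y \<in> U"
    unfolding eventually_nhds_fractional_ideal by blast
next
  assume "\<forall>x\<in>U. \<exists>k. \<forall>y. y - x \<in> fractional_ideal k \<longrightarrow> y \<in> U"
  then have "\<forall>\<^sub>F y in nhds x. y \<in> U" if "x \<in> U" for x
    unfolding eventually_nhds_fractional_ideal using that by blast
  note near = this
  show "open U"
  proof (rule Topological_Spaces.openI)
    fix x assume "x \<in> U"
    obtain T where "open T" "x \<in> T" "\<forall>y\<in>T. y \<in> U"
      using near[OF \<open>x \<in> U\<close>] unfolding eventually_nhds by (elim exE conjE)
    then show "\<exists>T. open T \<and> x \<in> T \<and> T \<subseteq> U"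
      by (intro exI[of _ T]) (simp add: subset_iff)
  qed
qed

lemma compact_subfield_bounded_part:
  fixes F :: "'k::discretely_valued_field set"
  assumes F: "is_subfield F" "compact (F \<inter> fractional_ideal 0)" and c: "\<exists>c\<in>F. c \<noteq> 0 \<and> ord_K c > 0"
  shows "compact (F \<inter> fractional_ideal j)"
proof -
  obtain c where c: "c \<in> F" "c \<noteq> 0" "ord_K c > 0" using c by blast
  define d where "d = inverse c ^ nat (- j)"
  have "inverse c ^ n \<in> F" for n
    by (induction n) (use c F in \<open>auto simp: subfield_closed\<close>)
  then have d: "d \<in> F" "d \<noteq> 0" using c by (auto simp: d_def)
  have "ord_K d = int (nat (- j)) * - ord_K c"
    using c by (simp add: d_def ord_K_power ord_K_inverse)
  also have "\<dots> \<le> int (nat (- j)) * - 1"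
    using c by (intro mult_left_mono) auto
  finally have "ord_K d \<le> j" by linarith
  have "F \<inter> fractional_ideal j = (\<lambda>x. d * x) ` (F \<inter> fractional_ideal 0) \<inter> fractional_ideal j"
  proof (intro subset_antisym subsetI)
    fix x assume x: "x \<in> F \<inter> fractional_ideal j"
    have "inverse d * x \<in> fractional_ideal 0"
      using x d \<open>ord_K d \<le> j\<close> by (auto simp: fractional_ideal_scale ord_K_inverse elim: fractional_ideal_antimono[rotated])
    moreover have "inverse d * x \<in> F" using x d F by (simp add: subfield_closed)
    moreover have "x = d * (inverse d * x)" using d by simp
    ultimately show "x \<in> (\<lambda>x. d * x) ` (F \<inter> fractional_ideal 0) \<inter> fractional_ideal j"
      using x by blast
  qed (use d F in \<open>auto simp: subfield_closed\<close>)
  then show ?thesis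
    using F(2) by (auto intro!: compact_Int_closed closed_fractional_ideal compact_continuous_image
        continuous_intros)
qed

text \<open>
  Closedness is a local matter, and every point has a neighborhood that lies inside a single
  fractional ideal.
\<close>

lemma closed_if_bounded_parts_compact:
  fixes V :: "'k::discretely_valued_field set"
  assumes "\<And>j. compact (V \<inter> fractional_ideal j)"
  shows "closed V"
  unfolding closed_def open_iff_fractional_ideal
proof
  fix x assume x: "x \<in> - V"
  obtain j where j: "x \<in> fractional_ideal j" using mem_some_fractional_ideal by blast
  have "open (- (V \<inter> fractional_ideal j))"
    using assms[of j] by (intro open_Compl compact_imp_closed)
  then obtain k where k: "\<And>y. y - x \<in> fractional_ideal k \<Longrightarrow> y \<in> - (V \<inter> fractional_ideal j)"
    unfolding open_iff_fractional_ideal using x by blast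
  have "y \<in> - V" if y: "y - x \<in> fractional_ideal (max j k)" for y
  proof -
    have "y - x + x \<in> fractional_ideal j"
      by (rule fractional_ideal_add[OF fractional_ideal_antimono[OF max.cobounded1 y] j])
    moreover have "y \<in> - (V \<inter> fractional_ideal j)"
      by (rule k[OF fractional_ideal_antimono[OF max.cobounded2 y]])
    ultimately show ?thesis by simp
  qed
  then show "\<exists>k. \<forall>y. y - x \<in> fractional_ideal k \<longrightarrow> y \<in> - V" by blast
qed

definition span_over :: "'k::field set \<Rightarrow> 'k set \<Rightarrow> 'k set" where
  "span_over F B = {(\<Sum>b\<in>B. c b * b) | c. \<forall>b\<in>B. c b \<in> F}"

lemma span_over_insert:
  assumes "finite B" "b \<notin> B"
  shows "span_over F (insert b B) = {v + c * b | v c. v \<in> span_over F B \<and> c \<in> F}"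
proof (intro subset_antisym subsetI)
  fix x assume "x \<in> span_over F (insert b B)"
  then obtain c where "x = (\<Sum>a\<in>insert b B. c a * a)" "\<forall>a\<in>insert b B. c a \<in> F"
    by (auto simp: span_over_def)
  then show "x \<in> {v + c * b | v c. v \<in> span_over F B \<and> c \<in> F}"
    using assms unfolding span_over_def
    by (intro CollectI exI[of _ "\<Sum>a\<in>B. c a * a"] exI[of _ "c b"]) (auto simp: add.commute)
next
  fix x assume "x \<in> {v + c * b | v c. v \<in> span_over F B \<and> c \<in> F}"
  then obtain c d where cd: "x = (\<Sum>a\<in>B. c a * a) + d * b" "\<forall>a\<in>B. c a \<in> F" "d \<in> F"
    by (auto simp: span_over_def)
  have "(\<Sum>a\<in>B. (c(b := d)) a * a) = (\<Sum>a\<in>B. c a * a)"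
    using assms by (intro sum.cong) auto
  then have "x = (\<Sum>a\<in>insert b B. (c(b := d)) a * a)" "\<forall>a\<in>insert b B. (c(b := d)) a \<in> F"
    using cd assms by auto
  then show "x \<in> span_over F (insert b B)"
    unfolding span_over_def by blast
qed

lemma span_over_scale:
  assumes "is_subfield F" "c \<in> F" "v \<in> span_over F B"
  shows "c * v \<in> span_over F B"
proof -
  obtain a where "v = (\<Sum>b\<in>B. a b * b)" "\<forall>b\<in>B. a b \<in> F"
    using assms by (auto simp: span_over_def)
  then show ?thesis
    using assms unfolding span_over_def
    by (auto intro!: exI[of _ "\<lambda>b. c * a b"] simp: sum_distrib_left subfield_closed mult.assoc)
qed

lemma span_over_add:
  assumes "is_subfield F" "v \<in> span_over F B" "w \<in> span_over F B"
  shows "v + w \<in> span_over F B"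
proof -
  obtain a a' where "v = (\<Sum>b\<in>B. a b * b)" "\<forall>b\<in>B. a b \<in> F" "w = (\<Sum>b\<in>B. a' b * b)" "\<forall>b\<in>B. a' b \<in> F"
    using assms by (auto simp: span_over_def)
  then show ?thesis
    using assms unfolding span_over_def
    by (auto intro!: exI[of _ "\<lambda>b. a b + a' b"] simp: sum.distrib subfield_closed distrib_right)
qed

text \<open>
  A finite-dimensional subspace over a locally compact subfield is locally compact. The induction adds
  one vector \<open>b\<close> to a subspace \<open>V\<close> that is closed by the induction hypothesis, so that \<open>b\<close> has
  positive distance from \<open>V\<close>. By homogeneity this distance bounds the coefficient of \<open>b\<close> in every
  \<open>v + c * b\<close> of bounded size, and then also \<open>v\<close>. The bounded part is therefore cut out of a
  continuous image of a product of compact sets.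
\<close>

lemma span_over_bounded_parts_compact:
  fixes F :: "'k::discretely_valued_field set"
  assumes F: "is_subfield F" and cF: "\<And>j. compact (F \<inter> fractional_ideal j)" and "finite B"
  shows "compact (span_over F B \<inter> fractional_ideal j)"
  using \<open>finite B\<close>
proof (induction B arbitrary: j rule: finite_induct)
  case empty
  have "span_over F {} \<inter> fractional_ideal j = {0}" by (auto simp: span_over_def)
  then show ?case by simp
next
  case (insert b B)
  let ?V = "span_over F B"
  show ?case
  proof (cases "b \<in> ?V")
    case True
    have "span_over F (insert b B) = ?V"
    proof (intro subset_antisym subsetI)
      fix x assume "x \<in> ?V"
      then show "x \<in> span_over F (insert b B)"
        unfolding span_over_insert[OF insert.hyps]
        using subfield_closed(1)[OF F] by (intro CollectI exI[of _ x] exI[of _ 0]) auto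
    qed (use True F in \<open>auto simp: span_over_insert[OF insert.hyps] intro!: span_over_add span_over_scale\<close>)
    then show ?thesis using insert.IH by simp
  next
    case False
    have "open (- ?V)"
      using closed_if_bounded_parts_compact[OF insert.IH] by (simp add: closed_def)
    then obtain k where k: "\<And>y. y - b \<in> fractional_ideal k \<Longrightarrow> y \<notin> ?V"
      unfolding open_iff_fractional_ideal using False by blast
    obtain s where s: "b \<in> fractional_ideal s" using mem_some_fractional_ideal by blast
    define i where "i = min j (j - k + s)"
    let ?f = "\<lambda>(v, c). v + c * b"
    let ?Z = "(?V \<inter> fractional_ideal i) \<times> (F \<inter> fractional_ideal (j - k))"
    have "span_over F (insert b B) \<inter> fractional_ideal j = ?f ` ?Z \<inter> fractional_ideal j"
    proof (intro subset_antisym subsetI)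
      fix x assume "x \<in> span_over F (insert b B) \<inter> fractional_ideal j"
      then obtain v c where x: "x = v + c * b" "v \<in> ?V" "c \<in> F" "x \<in> fractional_ideal j"
        unfolding span_over_insert[OF insert.hyps] by blast
      have c: "c \<in> fractional_ideal (j - k)"
      proof (cases "c = 0")
        case False
        \<comment> \<open>Dividing by \<open>c\<close> exhibits a point of the old subspace close to \<open>b\<close>.\<close>
        have "- inverse c * v \<in> ?V"
          using F x by (intro span_over_scale) (auto simp: subfield_closed)
        then have "- inverse c * v - b \<notin> fractional_ideal k" using k by blast
        moreover have "- inverse c * v - b = (- inverse c) * x"
          using False x(1) by (simp add: field_simps)
        ultimately have "x \<notin> fractional_ideal (k + ord_K c)"
          using False by (simp add: fractional_ideal_scale ord_K_inverse)
        then have "\<not> k + ord_K c \<le> j" using x(4) fractional_ideal_antimono by blast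
        then show ?thesis by (simp add: fractional_ideal_def)
      qed simp
      have "c * b \<in> fractional_ideal (j - k + s)"
        using c s by (rule fractional_ideal_mult)
      then have "x - c * b \<in> fractional_ideal i"
        using x(4) unfolding i_def
        by (intro fractional_ideal_diff) (auto elim!: fractional_ideal_antimono[rotated])
      then have "(v, c) \<in> ?Z" using x c by simp
      then show "x \<in> ?f ` ?Z \<inter> fractional_ideal j" using x by force
    qed (auto simp: span_over_insert[OF insert.hyps])
    moreover have "compact ?Z"
      using insert.IH cF by (intro compact_Times)
    moreover have "continuous_on ?Z ?f"
      by (auto simp: case_prod_unfold intro!: continuous_intros)
    ultimately show ?thesis
      by (auto intro!: compact_Int_closed closed_fractional_ideal compact_continuous_image)
  qed
qed

text \<open>
  The field itself is a finite-dimensional space over its locally compact base field.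
\<close>

theorem local_field_compact_fractional_ideal:
  assumes "nonarch_local_field TYPE('k::discretely_valued_field)"
  shows "compact (fractional_ideal j :: 'k set)"
proof -
  obtain F :: "'k set" where F: "finite_extension_of F"
    and base: "(\<exists>p. is_padic_field F p) \<or> (\<exists>k. is_laurent_series_field F k)"
    using assms by (auto simp: nonarch_local_field_def)
  have sub: "is_subfield F" using F by (simp add: finite_extension_of_def)
  have cF: "compact (F \<inter> fractional_ideal i)" for i
    using base
  proof (elim disjE exE)
    fix p assume p: "is_padic_field F p"
    show ?thesis
      by (rule compact_subfield_bounded_part[OF sub padic_field_compact[OF p]])
  next
    fix k assume k: "is_laurent_series_field F k"
    show ?thesis
      by (rule compact_subfield_bounded_part[OF sub laurent_series_field_compact[OF k]])
  qed
  obtain B where B: "finite B" "\<forall>x. \<exists>c. (\<forall>b\<in>B. c b \<in> F) \<and> x = (\<Sum>b\<in>B. c b * b)"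
    using F unfolding finite_extension_of_def by blast
  then have "span_over F B = UNIV"
    unfolding span_over_def by blast
  then show ?thesis
    using span_over_bounded_parts_compact[OF sub cF B(1), of j] by simp
qed

section \<open>Lattices\<close>

text \<open>
  The lattices \<open>lattice k\<close> are compact open subgroups that form a basis of neighborhoods of zero. They
  serve as balls: every notion of size in the vector space is expressed by membership in them.
\<close>

definition lattice :: "int \<Rightarrow> ('k::discretely_valued_field ^ 'd) set" where
  "lattice k = {x. \<forall>i. x $ i \<in> fractional_ideal k}"

lemma lattice_0 [simp]: "0 \<in> lattice k"
  by (simp add: lattice_def)

lemma lattice_add: "x \<in> lattice k \<Longrightarrow> y \<in> lattice k \<Longrightarrow> x + y \<in> lattice k"
  by (simp add: lattice_def fractional_ideal_add)

lemma lattice_minus [simp]: "- x \<in> lattice k \<longleftrightarrow> x \<in> lattice k"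
  by (simp add: lattice_def)

lemma lattice_diff: "x \<in> lattice k \<Longrightarrow> y \<in> lattice k \<Longrightarrow> x - y \<in> lattice k"
  by (simp add: lattice_def fractional_ideal_diff)

lemma lattice_minus_commute: "x - y \<in> lattice k \<longleftrightarrow> y - x \<in> lattice k"
  using lattice_minus[of "x - y" k] by simp

lemma lattice_antimono: "j \<le> k \<Longrightarrow> x \<in> lattice k \<Longrightarrow> x \<in> lattice j"
  by (auto simp: lattice_def intro: fractional_ideal_antimono)

lemma lattice_scale: "c \<noteq> 0 \<Longrightarrow> c *s x \<in> lattice k \<longleftrightarrow> x \<in> lattice (k - ord_K c)"
  by (simp add: lattice_def fractional_ideal_scale)

lemma mem_some_lattice: "\<exists>k\<le>j. (x :: 'k::discretely_valued_field ^ 'd) \<in> lattice k"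
proof -
  define m where "m = Min (insert j (range (\<lambda>i. ord_K (x $ i))))"
  have "m \<le> ord_K (x $ i)" for i unfolding m_def by (intro Min_le) auto
  moreover have "m \<le> j" unfolding m_def by (intro Min_le) auto
  ultimately show ?thesis
    by (intro exI[of _ m]) (auto simp: lattice_def fractional_ideal_def)
qed

lemma not_mem_some_lattice: "x \<noteq> 0 \<Longrightarrow> \<exists>k. x \<notin> lattice k"
  using not_mem_some_fractional_ideal by (force simp: lattice_def vec_eq_iff)

lemma open_iff_lattice:
  fixes U :: "('k::discretely_valued_field ^ 'd) set"
  shows "open U \<longleftrightarrow> (\<forall>x\<in>U. \<exists>k. \<forall>y. y - x \<in> lattice k \<longrightarrow> y \<in> U)"
proof
  assume U: "open U"
  show "\<forall>x\<in>U. \<exists>k. \<forall>y. y - x \<in> lattice k \<longrightarrow> y \<in> U"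
  proof
    fix x assume "x \<in> U"
    then obtain A where A: "\<And>i. open (A i)" "\<And>i. x $ i \<in> A i" "\<And>y. (\<forall>i. y $ i \<in> A i) \<Longrightarrow> y \<in> U"
      using U unfolding open_vec_def by metis
    then have "\<forall>i. \<exists>k. \<forall>y. y - x $ i \<in> fractional_ideal k \<longrightarrow> y \<in> A i"
      unfolding open_iff_fractional_ideal by blast
    then obtain k where k: "\<And>i y. y - x $ i \<in> fractional_ideal (k i) \<Longrightarrow> y \<in> A i" by metis
    have "k i \<le> Max (range k)" for i by (intro Max_ge) auto
    then have "y \<in> U" if "y - x \<in> lattice (Max (range k))" for y
      using that k A(3) fractional_ideal_antimono unfolding lattice_def by (metis (mono_tags, lifting) mem_Collect_eq vector_minus_component)
    then show "\<exists>k. \<forall>y. y - x \<in> lattice k \<longrightarrow> y \<in> U" by blast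
  qed
next
  assume R: "\<forall>x\<in>U. \<exists>k. \<forall>y. y - x \<in> lattice k \<longrightarrow> y \<in> U"
  show "open U"
    unfolding open_vec_def
  proof
    fix x assume "x \<in> U"
    then obtain k where k: "\<And>y. y - x \<in> lattice k \<Longrightarrow> y \<in> U" using R by blast
    define A where "A i = {z. z - x $ i \<in> fractional_ideal k}" for i
    have "open (A i)" for i
      unfolding open_iff_fractional_ideal A_def
      using fractional_ideal_add[of _ k] by (fastforce intro!: exI[of _ k] simp: algebra_simps)
    moreover have "\<forall>y. (\<forall>i. y $ i \<in> A i) \<longrightarrow> y \<in> U"
      using k by (auto simp: A_def lattice_def)
    ultimately show "\<exists>S. (\<forall>i. open (S i) \<and> x $ i \<in> S i) \<and> (\<forall>y. (\<forall>i. y $ i \<in> S i) \<longrightarrow> y \<in> U)"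
      by (intro exI[of _ A]) (auto simp: A_def)
  qed
qed

lemma open_lattice_coset: "open {y. y - x \<in> lattice k}"
  unfolding open_iff_lattice
proof
  fix y assume y: "y \<in> {y. y - x \<in> lattice k}"
  have "z - x \<in> lattice k" if "z - y \<in> lattice k" for z
    using lattice_add[OF that, of "y - x"] y by simp
  then show "\<exists>j. \<forall>z. z - y \<in> lattice j \<longrightarrow> z \<in> {y. y - x \<in> lattice k}" by blast
qed

lemma closed_lattice_coset: "closed {y. y - x \<in> lattice k}"
  unfolding closed_def open_iff_lattice
proof
  fix y assume y: "y \<in> - {y. y - x \<in> lattice k}"
  have "z - x \<notin> lattice k" if "z - y \<in> lattice k" for z
    using lattice_diff[OF _ that, of "z - x"] y by auto
  then show "\<exists>j. \<forall>z. z - y \<in> lattice j \<longrightarrow> z \<in> - {y. y - x \<in> lattice k}" by blast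
qed

lemma compact_lattice:
  assumes "nonarch_local_field TYPE('k::discretely_valued_field)"
  shows "compact (lattice k :: ('k ^ 'd) set)"
proof -
  have "lattice k = (\<lambda>f. \<chi> i. f i) ` Pi UNIV (\<lambda>_::'d. fractional_ideal k :: 'k set)"
  proof (intro subset_antisym subsetI)
    fix x :: "'k ^ 'd" assume "x \<in> lattice k"
    then show "x \<in> (\<lambda>f. \<chi> i. f i) ` Pi UNIV (\<lambda>_. fractional_ideal k)"
      by (intro image_eqI[of _ _ "\<lambda>i. x $ i"]) (auto simp: lattice_def)
  qed (auto simp: lattice_def)
  moreover have "compact (Pi UNIV (\<lambda>_::'d. fractional_ideal k :: 'k set))"
    by (intro compact_PiE_euclidean local_field_compact_fractional_ideal assms)
  moreover have "continuous_on X (\<lambda>f. (\<chi> i. f i) :: 'k ^ 'd)" for X :: "('d \<Rightarrow> 'k) set"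
    by (intro continuous_on_vec_lambda continuous_on_subset[OF continuous_on_product_coordinates]) simp
  ultimately show ?thesis by (metis compact_continuous_image)
qed

lemma compact_lattice_coset:
  assumes "nonarch_local_field TYPE('k::discretely_valued_field)"
  shows "compact {y :: 'k ^ 'd. y - x \<in> lattice k}"
proof -
  obtain j where j: "j \<le> k" "x \<in> lattice j" using mem_some_lattice by blast
  have "{y. y - x \<in> lattice k} = lattice j \<inter> {y. y - x \<in> lattice k}"
    using lattice_add[OF lattice_antimono[OF j(1)] j(2)] by (fastforce simp: algebra_simps)
  then show ?thesis
    using compact_lattice[OF assms] closed_lattice_coset by (metis compact_Int_closed)
qed

lemma lattice_finite_representatives:
  assumes "nonarch_local_field TYPE('k::discretely_valued_field)"
  shows "\<exists>T\<subseteq>lattice j :: ('k ^ 'd) set. finite T \<and> (\<forall>x\<in>lattice j. \<exists>t\<in>T. x - t \<in> lattice k)"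
proof -
  let ?coset = "\<lambda>t. {y. y - t \<in> (lattice k :: ('k ^ 'd) set)}"
  have cover: "lattice j \<subseteq> (\<Union>t\<in>lattice j. ?coset t)"
    by auto
  have op: "open (?coset t)" for t by (rule open_lattice_coset)
  obtain T where T: "T \<subseteq> lattice j" "finite T" "lattice j \<subseteq> (\<Union>t\<in>T. ?coset t)"
    by (rule compactE_image[OF compact_lattice[OF assms, of j] op cover])
  show ?thesis
  proof (intro exI[of _ T] conjI ballI)
    fix x :: "'k ^ 'd" assume "x \<in> lattice j"
    then show "\<exists>t\<in>T. x - t \<in> lattice k" using T(3) by blast
  qed (use T in auto)
qed

section \<open>The normalized integral over the unit lattice\<close>

definition uniformizer :: "'k::discretely_valued_field" where
  "uniformizer = (SOME x. x \<noteq> 0 \<and> ord_K x = 1)"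

lemma uniformizer [simp]:
  "uniformizer \<noteq> (0::'k::discretely_valued_field)" "ord_K (uniformizer::'k) = 1"
  using someI_ex[OF ord_K_normalized[where 'a='k]] by (simp_all add: uniformizer_def)

text \<open>
  One representative for each class modulo \<open>lattice 1\<close>. Congruent
  vectors have equal representatives, because they pass the same predicate to the choice operator.
\<close>

definition residue_rep :: "'k::discretely_valued_field ^ 'd \<Rightarrow> 'k ^ 'd" where
  "residue_rep x = (SOME y. y - x \<in> lattice 1)"

definition residue_system :: "('k::discretely_valued_field ^ 'd) set" where
  "residue_system = residue_rep ` lattice 0"

lemma residue_rep: "residue_rep x - x \<in> lattice 1"
  unfolding residue_rep_def by (rule someI[of _ x]) simp

lemma residue_rep_eq_iff: "residue_rep x = residue_rep y \<longleftrightarrow> x - y \<in> lattice 1"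
proof
  assume "residue_rep x = residue_rep y"
  then show "x - y \<in> lattice 1"
    using lattice_diff[OF residue_rep[of y] residue_rep[of x]] by simp
next
  assume xy: "x - y \<in> lattice 1"
  have "z - x \<in> lattice 1 \<longleftrightarrow> z - y \<in> lattice 1" for z
    using lattice_add[of "z - x" 1 "x - y"] lattice_diff[of "z - y" 1 "x - y"] xy by auto
  then show "residue_rep x = residue_rep y" by (simp add: residue_rep_def)
qed

lemma residue_rep_in_unit_lattice: "x \<in> lattice 0 \<Longrightarrow> residue_rep x \<in> lattice 0"
  using lattice_add[OF lattice_antimono[OF _ residue_rep[of x], of 0], of x] by simp

lemma residue_system_subset: "residue_system \<subseteq> lattice 0"
  by (auto simp: residue_system_def residue_rep_in_unit_lattice)

lemma residue_rep_id: "r \<in> residue_system \<Longrightarrow> residue_rep r = r"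
  by (auto simp: residue_system_def residue_rep_eq_iff residue_rep)

lemma finite_residue_system:
  assumes "nonarch_local_field TYPE('k::discretely_valued_field)"
  shows "finite (residue_system :: ('k ^ 'd) set)"
proof -
  obtain T where T: "finite T" "\<forall>x\<in>lattice 0 :: ('k ^ 'd) set. \<exists>t\<in>T. x - t \<in> lattice 1"
    using lattice_finite_representatives[OF assms] by meson
  have "residue_system \<subseteq> residue_rep ` T"
  proof
    fix r :: "'k ^ 'd" assume "r \<in> residue_system"
    then obtain x where x: "x \<in> lattice 0" "r = residue_rep x"
      by (auto simp: residue_system_def)
    then obtain t where "t \<in> T" "x - t \<in> lattice 1" using T by blast
    then show "r \<in> residue_rep ` T" using x residue_rep_eq_iff[of x t] by simp
  qed
  then show ?thesis using T finite_surj by blast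
qed

lemma residue_system_nonempty: "residue_system \<noteq> {}"
  using lattice_0[of 0] by (auto simp: residue_system_def simp del: lattice_0)

lemma residue_translation_bij:
  fixes a :: "'k::discretely_valued_field ^ 'd"
  assumes "nonarch_local_field TYPE('k)" "a \<in> lattice 0"
  shows "bij_betw (\<lambda>r. residue_rep (r + a)) residue_system residue_system"
proof -
  have inj: "inj_on (\<lambda>r. residue_rep (r + a)) residue_system"
  proof (rule inj_onI)
    fix r s assume rs: "r \<in> residue_system" "s \<in> residue_system"
      and "residue_rep (r + a) = residue_rep (s + a)"
    then have "r - s \<in> lattice 1" by (simp add: residue_rep_eq_iff)
    then have "residue_rep r = residue_rep s" by (simp add: residue_rep_eq_iff)
    then show "r = s" using rs by (simp add: residue_rep_id)
  qed
  have "(\<lambda>r. residue_rep (r + a)) ` residue_system \<subseteq> residue_system"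
    using residue_system_subset assms(2) lattice_add unfolding residue_system_def by blast
  then show ?thesis
    using endo_inj_surj[OF finite_residue_system[OF assms(1)] _ inj] inj by (simp add: bij_betw_def)
qed

text \<open>
  The Haar integral over the unit lattice is obtained from self-similarity: the unit lattice is the
  disjoint union of the translates \<open>r + uniformizer *s lattice 0\<close> by residue representatives, each a
  scaled copy of the whole. Averaging over these pieces \<open>m\<close> times samples a function at one point of
  every class modulo \<open>lattice m\<close>, which is exact for functions that depend on the class only. The limit
  makes the value independent of \<open>m\<close>.
\<close>

primrec mean_upto :: "nat \<Rightarrow> ('k::discretely_valued_field ^ 'd \<Rightarrow> complex) \<Rightarrow> complex" where
  "mean_upto 0 f = f 0"
| "mean_upto (Suc m) f =
     (\<Sum>r\<in>residue_system. mean_upto m (\<lambda>x. f (r + uniformizer *s x))) / of_nat (card (residue_system :: ('k ^ 'd) set))"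

definition lattice_mean :: "('k::discretely_valued_field ^ 'd \<Rightarrow> complex) \<Rightarrow> complex" where
  "lattice_mean f = lim (\<lambda>m. mean_upto m f)"

text \<open>
  Only arguments in the unit lattice matter, since the averages never leave it.
\<close>

definition factors_mod :: "nat \<Rightarrow> ('k::discretely_valued_field ^ 'd \<Rightarrow> complex) \<Rightarrow> bool" where
  "factors_mod m f \<longleftrightarrow> (\<forall>x\<in>lattice 0. \<forall>y\<in>lattice (int m). f (x + y) = f x)"

lemma factors_mod_mono:
  assumes "factors_mod m f" "m \<le> k" shows "factors_mod k f"
  using assms lattice_antimono[of "int m" "int k"] by (force simp: factors_mod_def)

lemma factors_mod_rescale:
  fixes f :: "'k::discretely_valued_field ^ 'd \<Rightarrow> complex"
  assumes "factors_mod (Suc m) f" "r \<in> lattice 0"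
  shows "factors_mod m (\<lambda>x. f (r + uniformizer *s x))"
  unfolding factors_mod_def
proof (intro ballI)
  fix x y :: "'k ^ 'd" assume x: "x \<in> lattice 0" and y: "y \<in> lattice (int m)"
  have "uniformizer *s x \<in> lattice 0"
    using x by (simp add: lattice_scale lattice_antimono[of "-1" 0])
  moreover have "uniformizer *s y \<in> lattice (int (Suc m))"
    using y by (simp add: lattice_scale)
  ultimately have "f ((r + uniformizer *s x) + uniformizer *s y) = f (r + uniformizer *s x)"
    using assms unfolding factors_mod_def by (blast intro: lattice_add)
  then show "f (r + uniformizer *s (x + y)) = f (r + uniformizer *s x)"
    by (simp add: vector_add_ldistrib add.assoc)
qed

lemma factors_mod_0_iff: "factors_mod 0 f \<longleftrightarrow> (\<forall>x\<in>lattice 0. f x = f 0)"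
proof
  assume f: "factors_mod 0 f"
  show "\<forall>x\<in>lattice 0. f x = f 0"
  proof
    fix x :: "('a, 'b) vec" assume x: "x \<in> lattice 0"
    show "f x = f 0"
      using bspec[OF bspec[OF f[unfolded factors_mod_def of_nat_0] lattice_0] x] by (simp only: add_0)
  qed
next
  assume f: "\<forall>x\<in>lattice 0. f x = f 0"
  show "factors_mod 0 f"
    unfolding factors_mod_def of_nat_0
  proof (intro ballI)
    fix x y :: "('a, 'b) vec" assume "x \<in> lattice 0" "y \<in> lattice 0"
    then show "f (x + y) = f x" using f lattice_add by metis
  qed
qed

lemma mean_upto_const:
  assumes "nonarch_local_field TYPE('k::discretely_valued_field)" "factors_mod 0 (f :: 'k ^ 'd \<Rightarrow> complex)"
  shows "mean_upto k f = f 0"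
  using assms(2)
proof (induction k arbitrary: f)
  case (Suc k)
  have "mean_upto k (\<lambda>x. f (r + uniformizer *s x)) = f 0" if r: "r \<in> residue_system" for r
  proof -
    have "r \<in> lattice 0" using r residue_system_subset by blast
    have const: "f x = f 0" if "x \<in> lattice 0" for x
      using Suc.prems that unfolding factors_mod_0_iff by blast
    have in0: "r + uniformizer *s x \<in> lattice 0" if "x \<in> lattice 0" for x
      using \<open>r \<in> lattice 0\<close> that by (intro lattice_add) (simp_all add: lattice_scale lattice_antimono[of "-1" 0])
    have "factors_mod 0 (\<lambda>x. f (r + uniformizer *s x))"
      unfolding factors_mod_0_iff
      by (intro ballI) (rule trans[OF const[OF in0] const[OF in0[OF lattice_0], symmetric]])
    then have "mean_upto k (\<lambda>x. f (r + uniformizer *s x)) = f (r + uniformizer *s 0)"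
      by (rule Suc.IH)
    also have "\<dots> = f 0"
      by (rule const[OF in0[OF lattice_0]])
    finally show ?thesis .
  qed
  then show ?case
    using finite_residue_system[OF assms(1), where 'd='d] residue_system_nonempty[where 'a='k and 'b='d]
    by simp
qed simp

text \<open>
  Passing to one of the pieces lowers the level at which the function becomes constant by one; at level
  zero it is constant and further averaging has no effect.
\<close>

lemma mean_upto_eventually_const:
  assumes "nonarch_local_field TYPE('k::discretely_valued_field)"
    and "factors_mod m (f :: 'k ^ 'd \<Rightarrow> complex)" "m \<le> k"
  shows "mean_upto k f = mean_upto m f"
  using assms(2,3)
proof (induction m arbitrary: f k)
  case 0
  then show ?case using mean_upto_const[OF assms(1)] by simp
next
  case (Suc m)
  then obtain k' where k': "k = Suc k'" "m \<le> k'" by (cases k) auto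
  have "mean_upto k' (\<lambda>x. f (r + uniformizer *s x)) = mean_upto m (\<lambda>x. f (r + uniformizer *s x))"
    if "r \<in> residue_system" for r
    using that residue_system_subset Suc.prems k' by (intro Suc.IH factors_mod_rescale) auto
  then show ?case using k' by simp
qed

lemma lattice_mean_eq:
  assumes "nonarch_local_field TYPE('k::discretely_valued_field)" "factors_mod m (f :: 'k ^ 'd \<Rightarrow> complex)"
  shows "lattice_mean f = mean_upto m f"
  unfolding lattice_mean_def
proof (rule limI)
  have "\<forall>\<^sub>F k in sequentially. mean_upto k f = mean_upto m f"
    by (rule eventually_mono[OF eventually_ge_at_top[of m]]) (rule mean_upto_eventually_const[OF assms])
  then show "(\<lambda>k. mean_upto k f) \<longlonglongrightarrow> mean_upto m f" by (rule tendsto_eventually)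
qed

lemma mean_upto_add: "mean_upto m (\<lambda>x. f x + g x) = mean_upto m f + mean_upto m g"
  by (induction m arbitrary: f g) (simp_all add: sum.distrib add_divide_distrib)

lemma mean_upto_cmult: "mean_upto m (\<lambda>x. c * f x) = c * mean_upto m f"
  by (induction m arbitrary: f) (simp_all add: sum_distrib_left)

lemma lattice_mean_add:
  assumes K: "nonarch_local_field TYPE('k::discretely_valued_field)"
    and "factors_mod m (f :: 'k ^ 'd \<Rightarrow> complex)" "factors_mod m g"
  shows "lattice_mean (\<lambda>x. f x + g x) = lattice_mean f + lattice_mean g"
proof -
  have "factors_mod m (\<lambda>x. f x + g x)" using assms by (simp add: factors_mod_def)
  then show ?thesis using assms by (simp add: lattice_mean_eq[OF K] mean_upto_add)
qed

lemma lattice_mean_cmult: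
  assumes K: "nonarch_local_field TYPE('k::discretely_valued_field)"
    and "factors_mod m (f :: 'k ^ 'd \<Rightarrow> complex)"
  shows "lattice_mean (\<lambda>x. c * f x) = c * lattice_mean f"
proof -
  have "factors_mod m (\<lambda>x. c * f x)" using assms by (simp add: factors_mod_def)
  then show ?thesis using assms by (simp add: lattice_mean_eq[OF K] mean_upto_cmult)
qed

lemma lattice_mean_const:
  assumes "nonarch_local_field TYPE('k::discretely_valued_field)"
    and "\<And>x. x \<in> lattice 0 \<Longrightarrow> (f :: 'k ^ 'd \<Rightarrow> complex) x = c"
  shows "lattice_mean f = c"
proof -
  have "factors_mod 0 f" unfolding factors_mod_0_iff using assms(2)[OF lattice_0] assms(2) by metis
  then show ?thesis using lattice_mean_eq[OF assms(1), of 0 f] assms(2)[of 0] by simp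
qed

text \<open>
  Translating by \<open>a\<close> permutes the pieces by \<open>r \<mapsto> residue_rep (r + a)\<close> and translates inside each of
  them, where the induction hypothesis applies.
\<close>

lemma mean_upto_translate:
  assumes K: "nonarch_local_field TYPE('k::discretely_valued_field)"
    and "factors_mod m (f :: 'k ^ 'd \<Rightarrow> complex)" "a \<in> lattice 0"
  shows "mean_upto m (\<lambda>x. f (x + a)) = mean_upto m f"
  using assms(2,3)
proof (induction m arbitrary: f a)
  case 0
  then have "f a = f 0" unfolding factors_mod_0_iff by blast
  then show ?case by simp
next
  case (Suc m)
  define t where "t r = residue_rep (r + a)" for r
  have "mean_upto m (\<lambda>x. f (r + uniformizer *s x + a)) = mean_upto m (\<lambda>x. f (t r + uniformizer *s x))"
    if r: "r \<in> residue_system" for r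
  proof -
    define b where "b = inverse uniformizer *s (r + a - t r)"
    have "r + a - t r \<in> lattice 1"
      unfolding t_def by (rule lattice_minus_commute[THEN iffD1, OF residue_rep])
    then have "b \<in> lattice 0"
      unfolding b_def by (subst lattice_scale) (simp_all add: ord_K_inverse)
    have tr: "t r \<in> lattice 0"
      using r Suc.prems residue_system_subset unfolding t_def
      by (intro residue_rep_in_unit_lattice lattice_add) auto
    have "r + uniformizer *s x + a = t r + uniformizer *s (x + b)" for x
      by (simp add: b_def vec_eq_iff algebra_simps)
    then have "(\<lambda>x. f (r + uniformizer *s x + a)) = (\<lambda>x. f (t r + uniformizer *s (x + b)))"
      by (simp only:)
    then show ?thesis
      using Suc.IH[OF factors_mod_rescale[OF Suc.prems(1) tr] \<open>b \<in> lattice 0\<close>] by (simp only:)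
  qed
  then have "(\<Sum>r\<in>residue_system. mean_upto m (\<lambda>x. f (r + uniformizer *s x + a))) =
      (\<Sum>r\<in>residue_system. mean_upto m (\<lambda>x. f (t r + uniformizer *s x)))"
    by (rule sum.cong[OF refl])
  also have "\<dots> = (\<Sum>r\<in>residue_system. mean_upto m (\<lambda>x. f (r + uniformizer *s x)))"
    using sum.reindex_bij_betw[OF residue_translation_bij[OF K Suc.prems(2)],
        of "\<lambda>r. mean_upto m (\<lambda>x. f (r + uniformizer *s x))"] by (simp add: t_def)
  finally show ?case by simp
qed

text \<open>
  The orthogonality argument for characters: translation invariance forces the mean to equal \<open>c\<close> times
  itself.
\<close>

lemma lattice_mean_eq_0_if_quasi_periodic:
  assumes K: "nonarch_local_field TYPE('k::discretely_valued_field)"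
    and f: "factors_mod m (f :: 'k ^ 'd \<Rightarrow> complex)" and a: "a \<in> lattice 0"
    and q: "\<And>x. f (x + a) = c * f x" and "c \<noteq> 1"
  shows "lattice_mean f = 0"
proof -
  have "mean_upto m f = mean_upto m (\<lambda>x. f (x + a))"
    using mean_upto_translate[OF K f a] by simp
  also have "\<dots> = c * mean_upto m f" by (simp add: q mean_upto_cmult)
  finally show ?thesis using \<open>c \<noteq> 1\<close> lattice_mean_eq[OF K f] by simp
qed

section \<open>Test functions and characters\<close>

definition lattice_invariant :: "int \<Rightarrow> ('k::discretely_valued_field ^ 'd \<Rightarrow> complex) \<Rightarrow> bool" where
  "lattice_invariant m \<phi> \<longleftrightarrow> (\<forall>x. \<forall>y\<in>lattice m. \<phi> (x + y) = \<phi> x)"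

lemma lattice_invariant_mono: "lattice_invariant m \<phi> \<Longrightarrow> m \<le> k \<Longrightarrow> lattice_invariant k \<phi>"
  using lattice_antimono[of m k] by (force simp: lattice_invariant_def)

text \<open>
  Compactness of the support makes local constancy uniform. At a point outside the support one argues
  from the translated point if that lies in the support; otherwise both values vanish.
\<close>

lemma test_function_lattice_invariant:
  assumes "\<phi> \<in> test_functions UNIV"
  shows "\<exists>m::nat. lattice_invariant (int m) \<phi>"
proof -
  have "\<exists>k. \<forall>y. y - x \<in> lattice k \<longrightarrow> \<phi> y = \<phi> x" for x
  proof -
    obtain V where "open V" "x \<in> V" "\<forall>y\<in>V. \<phi> y = \<phi> x"
      using assms unfolding test_functions_def by blast
    then show ?thesis unfolding open_iff_lattice by meson
  qed
  then obtain k where k: "\<And>x y. y - x \<in> lattice (k x) \<Longrightarrow> \<phi> y = \<phi> x" by metis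
  have "compact (supp \<phi>)" using assms by (simp add: test_functions_def)
  moreover have "open {y. y - x \<in> lattice (k x)}" for x by (rule open_lattice_coset)
  moreover have "supp \<phi> \<subseteq> (\<Union>x\<in>supp \<phi>. {y. y - x \<in> lattice (k x)})" by auto
  ultimately obtain C where C: "C \<subseteq> supp \<phi>" "finite C" "supp \<phi> \<subseteq> (\<Union>x\<in>C. {y. y - x \<in> lattice (k x)})"
    by (rule compactE_image)
  define m where "m = nat (Max (insert 0 (k ` C)))"
  have km: "k c \<le> int m" if "c \<in> C" for c
  proof -
    have "k c \<le> Max (insert 0 (k ` C))" using that C(2) by (intro Max_ge) auto
    then show ?thesis by (simp add: m_def)
  qed
  have near: "\<phi> (x + y) = \<phi> x" if x: "x \<in> supp \<phi>" and y: "y \<in> lattice (int m)" for x y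
  proof -
    obtain c where c: "c \<in> C" "x - c \<in> lattice (k c)" using C(3) x by blast
    have "x + y - c \<in> lattice (k c)"
      using lattice_add[OF c(2) lattice_antimono[OF km[OF c(1)] y]] by (simp add: algebra_simps)
    then show ?thesis using k[of "x + y" c] k[of x c] c(2) by simp
  qed
  have nonzero: "x \<in> supp \<phi>" if "\<phi> x \<noteq> 0" for x
    unfolding supp_def using that by (intro subsetD[OF closure_subset]) simp
  have "\<phi> (x + y) = \<phi> x" if y: "y \<in> lattice (int m)" for x y
  proof (cases "x \<in> supp \<phi> \<or> x + y \<in> supp \<phi>")
    case True
    then show ?thesis
    proof
      assume "x \<in> supp \<phi>"
      then show ?thesis using y by (rule near)
    next
      assume "x + y \<in> supp \<phi>"
      moreover have "- y \<in> lattice (int m)" using y by simp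
      ultimately have "\<phi> (x + y + - y) = \<phi> (x + y)" by (rule near)
      then show ?thesis by simp
    qed
  next
    case False
    then show ?thesis using nonzero by metis
  qed
  then show ?thesis unfolding lattice_invariant_def by blast
qed

lemma indicator_coset_test_function:
  assumes "nonarch_local_field TYPE('k::discretely_valued_field)"
  shows "(\<lambda>x :: 'k ^ 'd. if x - x0 \<in> lattice k then 1 else 0) \<in> test_functions UNIV"
    and "supp (\<lambda>x :: 'k ^ 'd. if x - x0 \<in> lattice k then 1 else 0) = {x. x - x0 \<in> lattice k}"
    and "lattice_invariant k (\<lambda>x :: 'k ^ 'd. if x - x0 \<in> lattice k then 1 else 0)"
proof -
  let ?\<phi> = "\<lambda>x :: 'k ^ 'd. if x - x0 \<in> lattice k then 1 else 0 :: complex"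
  show supp: "supp ?\<phi> = {x. x - x0 \<in> lattice k}"
    by (simp add: supp_def closed_lattice_coset)
  show inv: "lattice_invariant k ?\<phi>"
    unfolding lattice_invariant_def
  proof (intro allI ballI)
    fix x y :: "'k ^ 'd" assume y: "y \<in> lattice k"
    have "x + y - x0 \<in> lattice k \<longleftrightarrow> x - x0 \<in> lattice k"
      using lattice_add[of "x - x0" k y] lattice_diff[of "x + y - x0" k y] y by (auto simp: algebra_simps)
    then show "?\<phi> (x + y) = ?\<phi> x" by simp
  qed
  have "\<exists>V. open V \<and> x \<in> V \<and> (\<forall>y\<in>V. ?\<phi> y = ?\<phi> x)" for x
  proof (intro exI conjI ballI)
    fix y assume "y \<in> {y. y - x \<in> lattice k}"
    then have "?\<phi> (x + (y - x)) = ?\<phi> x" using inv unfolding lattice_invariant_def by blast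
    then show "?\<phi> y = ?\<phi> x" by simp
  qed (auto simp: open_lattice_coset)
  moreover have "compact (supp ?\<phi>)"
    unfolding supp by (rule compact_lattice_coset[OF assms])
  ultimately show "?\<phi> \<in> test_functions UNIV"
    by (simp add: test_functions_def)
qed

lemma admissible_character_simps:
  assumes "admissible_character \<psi>"
  shows "\<psi> (x + y) = \<psi> x * \<psi> y" "x \<in> fractional_ideal 1 \<Longrightarrow> \<psi> x = 1" "\<psi> 0 = 1"
  using assms by (auto simp: admissible_character_def maximal_ideal_eq)

lemma pairing_simps:
  "pairing (x + y) z = pairing x z + pairing y z"
  "pairing x (z + w) = pairing x z + pairing x w"
  "pairing x (- z) = - pairing x z"
  "pairing x 0 = 0"
  by (simp_all add: pairing_def sum.distrib sum_negf algebra_simps)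

lemma pairing_lattice: "x \<in> lattice j \<Longrightarrow> z \<in> lattice k \<Longrightarrow> pairing x z \<in> fractional_ideal (j + k)"
  unfolding pairing_def by (intro fractional_ideal_sum fractional_ideal_mult) (auto simp: lattice_def)

text \<open>
  The lattices \<open>lattice k\<close> and \<open>lattice (1 - k)\<close> are dual to each other for the character. If some
  coordinate of \<open>\<zeta>\<close> is too large, a multiple of the corresponding axis vector pairs with \<open>\<zeta>\<close> to a
  unit-size element on which \<open>\<psi>\<close> is nontrivial.
\<close>

lemma character_detects_lattice:
  fixes \<zeta> :: "'k::discretely_valued_field ^ 'd"
  assumes \<psi>: "admissible_character \<psi>" and \<zeta>: "\<zeta> \<notin> lattice (1 - k)"
  shows "\<exists>a\<in>lattice k. \<psi> (pairing a \<zeta>) \<noteq> 1"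
proof -
  obtain i where i: "\<zeta> $ i \<notin> fractional_ideal (1 - k)" using \<zeta> by (auto simp: lattice_def)
  then have i0: "\<zeta> $ i \<noteq> 0" "ord_K (\<zeta> $ i) \<le> - k" by (auto simp: fractional_ideal_def)
  obtain z where z: "z \<in> valuation_ring" "\<psi> z \<noteq> 1"
    using \<psi> by (auto simp: admissible_character_def)
  then have z0: "z \<in> fractional_ideal 0" by (auto simp: valuation_ring_def fractional_ideal_def)
  define a where "a = axis i (inverse (\<zeta> $ i) * z)"
  have "inverse (\<zeta> $ i) * z \<in> fractional_ideal k"
    using z0 i0 by (simp add: fractional_ideal_scale ord_K_inverse fractional_ideal_antimono[of "k + ord_K (\<zeta> $ i)" 0])
  then have "a \<in> lattice k" by (auto simp: a_def lattice_def axis_def)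
  moreover have "pairing a \<zeta> = (\<Sum>j\<in>UNIV. if j = i then inverse (\<zeta> $ i) * z * \<zeta> $ i else 0)"
    unfolding pairing_def a_def axis_def by (intro sum.cong) auto
  then have "pairing a \<zeta> = z" using i0 by simp
  ultimately show ?thesis using z(2) by blast
qed

section \<open>Wave packets\<close>

text \<open>
  The average of \<open>\<phi>\<close> over the coset \<open>y + lattice n\<close> against the character of frequency \<open>- \<eta>\<close>; as a
  distribution it is a bump at \<open>y\<close> whose Fourier transform lives near \<open>\<eta>\<close>.
\<close>

definition packet :: "('k::discretely_valued_field \<Rightarrow> complex) \<Rightarrow> nat \<Rightarrow> 'k ^ 'd \<Rightarrow> 'k ^ 'd \<Rightarrow>
    ('k ^ 'd \<Rightarrow> complex) \<Rightarrow> complex" where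
  "packet \<psi> n y \<eta> \<phi> = lattice_mean (\<lambda>r. \<phi> (y + uniformizer ^ n *s r) *
     \<psi> (pairing (y + uniformizer ^ n *s r) (- \<eta>)))"

lemma uniformizer_power_lattice:
  "uniformizer ^ n *s r \<in> lattice k \<longleftrightarrow> r \<in> lattice (k - int n)"
  by (simp add: lattice_scale ord_K_power)

lemma packet_integrand_factors:
  fixes \<phi> :: "'k::discretely_valued_field ^ 'd \<Rightarrow> complex"
  assumes \<psi>: "admissible_character \<psi>" and \<phi>: "lattice_invariant m \<phi>"
  shows "\<exists>j. factors_mod j (\<lambda>r. \<phi> (y + uniformizer ^ n *s r) * \<psi> (pairing (y + uniformizer ^ n *s r) \<zeta>))"
proof -
  obtain s where s: "\<zeta> \<in> lattice s" using mem_some_lattice by blast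
  define j where "j = nat (max m (1 - s))"
  have j: "m \<le> int j" "1 \<le> int j + s" unfolding j_def by arith+
  have "\<phi> (y + uniformizer ^ n *s (r + t)) * \<psi> (pairing (y + uniformizer ^ n *s (r + t)) \<zeta>) =
      \<phi> (y + uniformizer ^ n *s r) * \<psi> (pairing (y + uniformizer ^ n *s r) \<zeta>)"
    if t: "t \<in> lattice (int j)" for r t
  proof -
    let ?x = "y + uniformizer ^ n *s r" and ?t = "uniformizer ^ n *s t"
    have x: "y + uniformizer ^ n *s (r + t) = ?x + ?t"
      by (simp add: vector_add_ldistrib add.assoc)
    have tj: "?t \<in> lattice (int j)"
      using t lattice_antimono[of "int j - int n" "int j"] by (simp add: uniformizer_power_lattice)
    have "?t \<in> lattice m" by (rule lattice_antimono[OF j(1) tj])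
    then have 1: "\<phi> (?x + ?t) = \<phi> ?x" using \<phi> by (simp add: lattice_invariant_def)
    have "pairing ?t \<zeta> \<in> fractional_ideal 1"
      by (rule fractional_ideal_antimono[OF j(2) pairing_lattice[OF tj s]])
    then have "\<psi> (pairing (?x + ?t) \<zeta>) = \<psi> (pairing ?x \<zeta>)"
      by (simp add: pairing_simps admissible_character_simps[OF \<psi>] del: vector_smult_component)
    with 1 show ?thesis unfolding x by (simp only:)
  qed
  then show ?thesis unfolding factors_mod_def by blast
qed

text \<open>
  The Fourier transform of a packet is again described by packets, with shifted frequency.
\<close>

lemma packet_modulate:
  assumes "admissible_character \<psi>"
  shows "packet \<psi> n y \<eta> (\<lambda>x. \<phi> x * \<psi> (pairing x \<xi>)) = packet \<psi> n y (\<eta> - \<xi>) \<phi>"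
proof -
  have "\<psi> (pairing x \<xi>) * \<psi> (pairing x (- \<eta>)) = \<psi> (pairing x (- (\<eta> - \<xi>)))" for x
    using pairing_simps(2)[of x \<xi> "- \<eta>"] admissible_character_simps(1)[OF assms] by simp
  then show ?thesis by (simp only: packet_def mult.assoc)
qed

text \<open>
  Some translation inside the lattice that leaves \<open>\<phi>\<close> unchanged multiplies the character by a constant
  other than one. The bound \<open>int n \<le> k\<close> keeps this translation inside the coset over which the average
  is taken.
\<close>

lemma packet_eq_0_if_oscillating:
  fixes \<phi> :: "'k::discretely_valued_field ^ 'd \<Rightarrow> complex"
  assumes K: "nonarch_local_field TYPE('k)" and \<psi>: "admissible_character \<psi>"
    and \<phi>: "lattice_invariant k \<phi>" and k: "int n \<le> k" and \<eta>: "\<eta> \<notin> lattice (1 - k)"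
  shows "packet \<psi> n y \<eta> \<phi> = 0"
proof -
  have "- \<eta> \<notin> lattice (1 - k)" using \<eta> by simp
  then obtain a where a: "a \<in> lattice k" "\<psi> (pairing a (- \<eta>)) \<noteq> 1"
    using character_detects_lattice[OF \<psi>] by blast
  define b where "b = inverse (uniformizer ^ n) *s a"
  have ab: "uniformizer ^ n *s b = a" by (simp add: b_def vec_eq_iff)
  have "b \<in> lattice (k - int n)" using a(1) uniformizer_power_lattice[of n b k] ab by simp
  then have b: "b \<in> lattice 0" using lattice_antimono[of 0 "k - int n"] k by simp
  let ?f = "\<lambda>r. \<phi> (y + uniformizer ^ n *s r) * \<psi> (pairing (y + uniformizer ^ n *s r) (- \<eta>))"
  have "?f (r + b) = \<psi> (pairing a (- \<eta>)) * ?f r" for r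
  proof -
    have "y + uniformizer ^ n *s (r + b) = (y + uniformizer ^ n *s r) + a"
      by (simp add: vector_add_ldistrib add.assoc ab)
    moreover have "\<phi> ((y + uniformizer ^ n *s r) + a) = \<phi> (y + uniformizer ^ n *s r)"
      using \<phi> a(1) by (simp add: lattice_invariant_def)
    ultimately show ?thesis
      by (simp only: pairing_simps(1) admissible_character_simps(1)[OF \<psi>]) simp
  qed
  moreover obtain j where "factors_mod j ?f"
    using packet_integrand_factors[OF \<psi> \<phi>] by blast
  ultimately show ?thesis
    unfolding packet_def using a(2) b by (intro lattice_mean_eq_0_if_quasi_periodic[OF K])
qed

lemma packet_local:
  fixes \<phi> :: "'k::discretely_valued_field ^ 'd \<Rightarrow> complex"
  assumes K: "nonarch_local_field TYPE('k)"
    and "\<And>r. r \<in> lattice (int n) \<Longrightarrow> \<phi> (y + r) * \<psi> (pairing (y + r) (- \<eta>)) = c"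
  shows "packet \<psi> n y \<eta> \<phi> = c"
  unfolding packet_def
  using assms(2) by (intro lattice_mean_const[OF K]) (simp add: uniformizer_power_lattice)

lemma packet_add:
  fixes \<phi> :: "'k::discretely_valued_field ^ 'd \<Rightarrow> complex"
  assumes K: "nonarch_local_field TYPE('k)" and \<psi>: "admissible_character \<psi>"
    and "lattice_invariant m \<phi>" "lattice_invariant m' \<phi>'"
  shows "packet \<psi> n y \<eta> (\<lambda>x. \<phi> x + \<phi>' x) = packet \<psi> n y \<eta> \<phi> + packet \<psi> n y \<eta> \<phi>'"
proof -
  let ?f = "\<lambda>r. \<phi> (y + uniformizer ^ n *s r) * \<psi> (pairing (y + uniformizer ^ n *s r) (- \<eta>))"
  let ?f' = "\<lambda>r. \<phi>' (y + uniformizer ^ n *s r) * \<psi> (pairing (y + uniformizer ^ n *s r) (- \<eta>))"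
  obtain j where j: "factors_mod j ?f" using packet_integrand_factors[OF \<psi> assms(3)] by blast
  obtain j' where j': "factors_mod j' ?f'" using packet_integrand_factors[OF \<psi> assms(4)] by blast
  have "factors_mod (max j j') ?f" "factors_mod (max j j') ?f'"
    by (rule factors_mod_mono[OF j max.cobounded1], rule factors_mod_mono[OF j' max.cobounded2])
  from lattice_mean_add[OF K this] show ?thesis
    by (simp only: packet_def distrib_right)
qed

lemma packet_cmult:
  fixes \<phi> :: "'k::discretely_valued_field ^ 'd \<Rightarrow> complex"
  assumes K: "nonarch_local_field TYPE('k)" and \<psi>: "admissible_character \<psi>"
    and "lattice_invariant m \<phi>"
  shows "packet \<psi> n y \<eta> (\<lambda>x. c * \<phi> x) = c * packet \<psi> n y \<eta> \<phi>"
proof -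
  obtain j where "factors_mod j (\<lambda>r. \<phi> (y + uniformizer ^ n *s r) * \<psi> (pairing (y + uniformizer ^ n *s r) (- \<eta>)))"
    using packet_integrand_factors[OF \<psi> assms(3)] by blast
  from lattice_mean_cmult[OF K this] show ?thesis
    by (simp only: packet_def mult.assoc)
qed

section \<open>Superpositions of wave packets\<close>

text \<open>
  Packets at positions \<open>y n\<close>, of shrinking scale \<open>n\<close> and with frequencies \<open>\<eta> n\<close>. For the sequences
  below only finitely many terms are nonzero on a given test function.
\<close>

definition packet_sum :: "('k::discretely_valued_field \<Rightarrow> complex) \<Rightarrow> (nat \<Rightarrow> 'k ^ 'd) \<Rightarrow> (nat \<Rightarrow> 'k ^ 'd) \<Rightarrow>
    ('k ^ 'd \<Rightarrow> complex) \<Rightarrow> complex" where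
  "packet_sum \<psi> y \<eta> \<phi> = (\<Sum>n. packet \<psi> n (y n) (\<eta> n) \<phi>)"

lemma fourier_packet_sum:
  assumes "admissible_character \<psi>"
  shows "fourier \<psi> \<phi> (packet_sum \<psi> y \<eta>) \<xi> = (\<Sum>n. packet \<psi> n (y n) (\<eta> n - \<xi>) \<phi>)"
  by (simp add: fourier_def packet_sum_def packet_modulate[OF assms])

text \<open>
  Once \<open>\<phi>\<close> is constant on the coset of the packet, only the oscillation is averaged; the frequency is
  far outside the dual lattice \<open>lattice (1 - n)\<close>.
\<close>

lemma packet_eventually_0:
  fixes \<phi> :: "'k::discretely_valued_field ^ 'd \<Rightarrow> complex"
  assumes K: "nonarch_local_field TYPE('k)" and \<psi>: "admissible_character \<psi>"
    and \<phi>: "lattice_invariant (int m) \<phi>" and \<eta>: "\<eta> \<notin> lattice (- 2 * int n)" and "m \<le> n"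
  shows "packet \<psi> n y \<eta> \<phi> = 0"
proof (rule packet_eq_0_if_oscillating[OF K \<psi>])
  show "lattice_invariant (int n) \<phi>"
    using \<open>m \<le> n\<close> by (intro lattice_invariant_mono[OF \<phi>]) simp
  show "\<eta> \<notin> lattice (1 - int n)"
    using \<eta> lattice_antimono[of "- 2 * int n" "1 - int n" \<eta>] by auto
qed simp

lemma packet_sum_distribution:
  fixes y :: "nat \<Rightarrow> 'k::discretely_valued_field ^ 'd"
  assumes K: "nonarch_local_field TYPE('k)" and \<psi>: "admissible_character \<psi>"
    and \<eta>: "\<And>n. \<eta> n \<notin> lattice (- 2 * int n)"
  shows "packet_sum \<psi> y \<eta> \<in> distributions UNIV"
proof -
  have summable: "summable (\<lambda>n. packet \<psi> n (y n) (\<eta> n) \<phi>)" if "lattice_invariant (int m) \<phi>" for m and \<phi> :: "'k ^ 'd \<Rightarrow> complex"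
    by (rule summable_finite[of "{..<m}"]) (use packet_eventually_0[OF K \<psi> that \<eta>] in auto)
  show ?thesis
    unfolding distributions_def
  proof (intro CollectI conjI ballI allI)
    fix \<phi> \<phi>' :: "'k ^ 'd \<Rightarrow> complex"
    assume "\<phi> \<in> test_functions UNIV" "\<phi>' \<in> test_functions UNIV"
    then obtain m m' where m: "lattice_invariant (int m) \<phi>" "lattice_invariant (int m') \<phi>'"
      using test_function_lattice_invariant by meson
    show "packet_sum \<psi> y \<eta> (\<lambda>x. \<phi> x + \<phi>' x) = packet_sum \<psi> y \<eta> \<phi> + packet_sum \<psi> y \<eta> \<phi>'"
      unfolding packet_sum_def packet_add[OF K \<psi> m]
      by (rule suminf_add[OF summable[OF m(1)] summable[OF m(2)], symmetric])
  next
    fix a and \<phi> :: "'k ^ 'd \<Rightarrow> complex"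
    assume "\<phi> \<in> test_functions UNIV"
    then obtain m where m: "lattice_invariant (int m) \<phi>"
      using test_function_lattice_invariant by meson
    show "packet_sum \<psi> y \<eta> (\<lambda>x. a * \<phi> x) = a * packet_sum \<psi> y \<eta> \<phi>"
      unfolding packet_sum_def packet_cmult[OF K \<psi> m] by (rule suminf_mult[OF summable[OF m]])
  qed
qed

lemma finite_family_in_lattice:
  fixes f :: "'i \<Rightarrow> 'k::discretely_valued_field ^ 'd"
  assumes "finite I"
  shows "\<exists>k\<le>j. \<forall>i\<in>I. f i \<in> lattice k"
  using assms
proof (induction I rule: finite_induct)
  case (insert i I)
  then obtain k where k: "k \<le> j" "\<forall>i\<in>I. f i \<in> lattice k" by blast
  obtain k' where "k' \<le> k" "f i \<in> lattice k'" using mem_some_lattice by blast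
  then show ?case using k lattice_antimono by (intro exI[of _ k']) auto
qed auto

text \<open>
  A term contributes to the Fourier transform at \<open>l *s \<xi>\<close> only if \<open>\<eta> n\<close> is within \<open>lattice (1 - n)\<close> of
  it. For the finitely many small \<open>n\<close> this is impossible once \<open>l\<close> is large. For large \<open>n\<close> the
  frequency \<open>\<eta> n\<close> is so much larger than this tolerance that, after division by \<open>l\<close>, it gives a
  direction close to \<open>\<xi>0\<close>; if the position \<open>y n\<close> is also close to \<open>x0\<close>, then a point of the conical
  set \<open>S\<close> lies in a neighborhood that is disjoint from \<open>S\<close>.
\<close>

lemma packet_sum_smooth_off_closed_cone:
  fixes y :: "nat \<Rightarrow> 'k::discretely_valued_field ^ 'd"
  assumes K: "nonarch_local_field TYPE('k)" and \<psi>: "admissible_character \<psi>"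
    and \<Lambda>: "\<And>l. l \<in> \<Lambda> \<Longrightarrow> inverse l \<in> \<Lambda>" "0 \<notin> \<Lambda>"
    and cone: "\<And>x \<xi> l. (x, \<xi>) \<in> S \<Longrightarrow> l \<in> \<Lambda> \<Longrightarrow> (x, l *s \<xi>) \<in> S"
    and S: "\<And>n. (y n, \<eta> n) \<in> S"
    and \<eta>: "\<And>n. \<eta> n \<notin> lattice (- 2 * int n)"
    and off: "\<And>x \<xi>. x - x0 \<in> lattice a \<Longrightarrow> \<xi> - \<xi>0 \<in> lattice b \<Longrightarrow> (x, \<xi>) \<notin> S"
    and b: "\<xi>0 \<notin> lattice b"
  shows "smooth_at \<psi> \<Lambda> UNIV (packet_sum \<psi> y \<eta>) x0 \<xi>0"
proof -
  define U where "U = {x. x - x0 \<in> lattice a}"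
  define V where "V = {\<xi>. \<xi> - \<xi>0 \<in> lattice b}"
  obtain c where c: "c \<le> b" "\<xi>0 \<in> lattice c" using mem_some_lattice by blast
  have V_lower: "\<xi> \<notin> lattice b" if "\<xi> \<in> V" for \<xi>
    using that b lattice_diff[of \<xi> b "\<xi> - \<xi>0"] by (auto simp: V_def)
  have V_upper: "\<xi> \<in> lattice c" if "\<xi> \<in> V" for \<xi>
    using that lattice_add[OF lattice_antimono[OF c(1)] c(2), of "\<xi> - \<xi>0"] by (auto simp: V_def)
  have "\<exists>N::int. \<forall>l\<in>\<Lambda>. ord_K l < N \<longrightarrow> (\<forall>\<xi>\<in>V. fourier \<psi> \<phi> (packet_sum \<psi> y \<eta>) (l *s \<xi>) = 0)"
    if \<phi>: "\<phi> \<in> test_functions UNIV" "supp \<phi> \<subseteq> U" for \<phi>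
  proof -
    obtain m :: nat where m: "lattice_invariant (int m) \<phi>"
      using test_function_lattice_invariant \<phi> by blast
    \<comment> \<open>From \<open>M\<close> on, \<open>\<phi>\<close> is constant on each coset and the tolerance after division by \<open>l\<close> is finer than \<open>b\<close>.\<close>
    define M where "M = max m (nat (b - c))"
    have M: "m \<le> M" "b - c \<le> int M" unfolding M_def by arith+
    \<comment> \<open>All frequencies with index below \<open>M\<close> lie in \<open>lattice s\<close>, which \<open>l *s \<xi>\<close> leaves when \<open>l\<close> is large.\<close>
    obtain s where s: "s \<le> 1 - int M" "\<forall>n\<in>{..<M}. \<eta> n \<in> lattice s"
      using finite_family_in_lattice[of "{..<M}" "1 - int M" \<eta>] by blast
    have "packet \<psi> n (y n) (\<eta> n - l *s \<xi>) \<phi> = 0"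
      if l: "l \<in> \<Lambda>" "ord_K l < s - b" and \<xi>: "\<xi> \<in> V" for l \<xi> n
    proof -
      have l0: "l \<noteq> 0" using l \<Lambda> by blast
      consider "n < M" | "M \<le> n" "y n \<notin> U" | "M \<le> n" "y n \<in> U" by linarith
      then show ?thesis
      proof cases
        case 1
        have "\<eta> n - l *s \<xi> \<notin> lattice (1 - int M)"
        proof
          assume close: "\<eta> n - l *s \<xi> \<in> lattice (1 - int M)"
          have "\<eta> n \<in> lattice s" using s(2) 1 by simp
          then have "\<eta> n - (\<eta> n - l *s \<xi>) \<in> lattice s"
            by (rule lattice_diff[OF _ lattice_antimono[OF s(1) close]])
          then have "\<xi> \<in> lattice (s - ord_K l)" using l0 by (simp add: lattice_scale)
          then have "\<xi> \<in> lattice b" using l(2) lattice_antimono[of b "s - ord_K l"] by simp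
          then show False using V_lower[OF \<xi>] by blast
        qed
        then show ?thesis
          using 1 M(1) by (intro packet_eq_0_if_oscillating[OF K \<psi> lattice_invariant_mono[OF m]]) auto
      next
        case 2
        have "\<phi> (y n) = 0"
        proof (rule ccontr)
          assume "\<phi> (y n) \<noteq> 0"
          then have "y n \<in> supp \<phi>" unfolding supp_def by (intro subsetD[OF closure_subset]) simp
          then show False using 2 \<phi> by blast
        qed
        moreover have "\<phi> (y n + r) = \<phi> (y n)" if "r \<in> lattice (int n)" for r
          using lattice_invariant_mono[OF m, of "int n"] 2 M(1) that by (auto simp: lattice_invariant_def)
        ultimately show ?thesis by (intro packet_local[OF K]) simp
      next
        case 3
        have "\<eta> n - l *s \<xi> \<notin> lattice (1 - int n)"
        proof
          assume close: "\<eta> n - l *s \<xi> \<in> lattice (1 - int n)"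
          have "l *s \<xi> \<notin> lattice (- 2 * int n)"
          proof
            assume "l *s \<xi> \<in> lattice (- 2 * int n)"
            moreover have "\<eta> n - l *s \<xi> \<in> lattice (- 2 * int n)"
              by (rule lattice_antimono[OF _ close]) simp
            ultimately have "(\<eta> n - l *s \<xi>) + l *s \<xi> \<in> lattice (- 2 * int n)"
              by (intro lattice_add)
            then show False using \<eta>[of n] by simp
          qed
          then have "\<not> - 2 * int n - ord_K l \<le> c"
            using V_upper[OF \<xi>] lattice_antimono l0 by (auto simp: lattice_scale)
          then have "b \<le> 1 - int n - ord_K l" using M 3 by linarith
          moreover have "inverse l *s (\<eta> n - l *s \<xi>) \<in> lattice (1 - int n - ord_K l)"
            using close l0 by (subst lattice_scale) (auto simp: ord_K_inverse)
          moreover have "inverse l *s (\<eta> n - l *s \<xi>) = inverse l *s \<eta> n - \<xi>"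
            using l0 by (simp add: vec_eq_iff algebra_simps)
          ultimately have "inverse l *s \<eta> n - \<xi> \<in> lattice b"
            using lattice_antimono by metis
          moreover have "\<xi> - \<xi>0 \<in> lattice b" using \<xi> by (simp add: V_def)
          ultimately have "inverse l *s \<eta> n - \<xi> + (\<xi> - \<xi>0) \<in> lattice b"
            by (rule lattice_add)
          then have "(y n, inverse l *s \<eta> n) \<notin> S"
            using 3 by (intro off) (auto simp: U_def)
          then show False using cone[OF S \<Lambda>(1)[OF l(1)]] by blast
        qed
        then show ?thesis
          using 3 M(1) by (intro packet_eq_0_if_oscillating[OF K \<psi> lattice_invariant_mono[OF m]]) auto
      qed
    qed
    then show ?thesis
      by (intro exI[of _ "s - b"]) (simp add: fourier_packet_sum[OF \<psi>])
  qed
  then show ?thesis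
    unfolding smooth_at_def
    by (intro exI[of _ U] exI[of _ V]) (auto simp: U_def V_def open_lattice_coset)
qed

text \<open>
  The test function is the indicator of a small coset around \<open>x0\<close>, and the Fourier transform is
  evaluated at the frequency \<open>\<eta> n\<close> of a packet that lies in this coset, in a direction close to \<open>\<xi>0\<close>.
  That packet contributes \<open>1\<close>. Since the sizes of the frequencies are pairwise different and each
  exceeds the tolerance of its packet, all others contribute \<open>0\<close>. This happens for \<open>\<eta> n\<close> of
  arbitrarily large size, so no bound \<open>N\<close> can work.
\<close>

lemma packet_sum_not_smooth_at_limit:
  fixes y :: "nat \<Rightarrow> 'k::discretely_valued_field ^ 'd"
  assumes K: "nonarch_local_field TYPE('k)" and \<psi>: "admissible_character \<psi>"
    and \<Lambda>: "0 \<notin> \<Lambda>"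
    and \<eta>: "\<And>n. \<eta> n \<notin> lattice (- 2 * int n)"
    and lacunary: "\<And>k n. k < n \<Longrightarrow> \<exists>t. \<eta> k \<in> lattice t \<and> \<eta> n \<notin> lattice t"
    and limit: "\<And>a b n0. \<exists>n\<ge>n0. y n - x0 \<in> lattice a \<and> (\<exists>l\<in>\<Lambda>. \<exists>\<zeta>. \<eta> n = l *s \<zeta> \<and> \<zeta> - \<xi>0 \<in> lattice b)"
  shows "\<not> smooth_at \<psi> \<Lambda> UNIV (packet_sum \<psi> y \<eta>) x0 \<xi>0"
proof
  assume "smooth_at \<psi> \<Lambda> UNIV (packet_sum \<psi> y \<eta>) x0 \<xi>0"
  then obtain U V where UV: "open U" "x0 \<in> U" "open V" "\<xi>0 \<in> V"
    and decay: "\<And>\<phi>. \<phi> \<in> test_functions UNIV \<Longrightarrow> supp \<phi> \<subseteq> U \<Longrightarrow>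
      \<exists>N::int. \<forall>l\<in>\<Lambda>. ord_K l < N \<longrightarrow> (\<forall>\<xi>\<in>V. fourier \<psi> \<phi> (packet_sum \<psi> y \<eta>) (l *s \<xi>) = 0)"
    unfolding smooth_at_def by blast
  obtain a0 where a0: "\<And>x. x - x0 \<in> lattice a0 \<Longrightarrow> x \<in> U"
    using UV(1,2) unfolding open_iff_lattice by blast
  obtain b where b: "\<And>\<xi>. \<xi> - \<xi>0 \<in> lattice b \<Longrightarrow> \<xi> \<in> V"
    using UV(3,4) unfolding open_iff_lattice by blast
  define A where "A = nat a0"
  have "a0 \<le> int A" unfolding A_def by arith
  define \<phi> :: "'k ^ 'd \<Rightarrow> complex" where "\<phi> = (\<lambda>x. if x - x0 \<in> lattice (int A) then 1 else 0)"
  have \<phi>: "\<phi> \<in> test_functions UNIV" "supp \<phi> = {x. x - x0 \<in> lattice (int A)}" "lattice_invariant (int A) \<phi>"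
    unfolding \<phi>_def by (rule indicator_coset_test_function[OF K])+
  have "supp \<phi> \<subseteq> U"
    unfolding \<phi>(2) using a0 lattice_antimono[OF \<open>a0 \<le> int A\<close>] by blast
  then obtain N :: int where N: "\<And>l \<xi>. l \<in> \<Lambda> \<Longrightarrow> ord_K l < N \<Longrightarrow> \<xi> \<in> V \<Longrightarrow>
      fourier \<psi> \<phi> (packet_sum \<psi> y \<eta>) (l *s \<xi>) = 0"
    using decay[OF \<phi>(1)] by blast
  obtain c where c: "c \<le> b" "\<xi>0 \<in> lattice c" using mem_some_lattice by blast
  obtain s where s: "s \<le> 1 - int A" "\<forall>n\<in>{..<A}. \<eta> n \<in> lattice s"
    using finite_family_in_lattice[of "{..<A}" "1 - int A" \<eta>] by blast
  \<comment> \<open>The three bounds make \<open>\<phi>\<close> constant on the coset of packet \<open>n\<close>, put \<open>\<eta> n\<close> outside \<open>lattice s\<close>, and force \<open>ord_K l < N\<close>.\<close>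
  obtain n l \<zeta> where n: "n \<ge> max A (max (nat (- s)) (nat (- c - N)))"
    and yn: "y n - x0 \<in> lattice (int A)" and l: "l \<in> \<Lambda>" "\<eta> n = l *s \<zeta>" and \<zeta>: "\<zeta> - \<xi>0 \<in> lattice b"
    using limit by meson
  have n: "A \<le> n" "- 2 * int n \<le> s" "- 2 * int n - c \<le> N" using n by arith+
  have l0: "l \<noteq> 0" using l \<Lambda> by blast
  have "\<zeta> \<in> lattice c"
    using lattice_add[OF lattice_antimono[OF c(1) \<zeta>] c(2)] by simp
  then have "\<not> - 2 * int n - ord_K l \<le> c"
    using \<eta>[of n] l l0 lattice_antimono by (auto simp: lattice_scale)
  then have "ord_K l < N" using n by linarith
  then have zero: "fourier \<psi> \<phi> (packet_sum \<psi> y \<eta>) (\<eta> n) = 0"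
    using N l b \<zeta> by simp
  have far: "\<eta> k - \<eta> n \<notin> lattice (1 - int k)" if kn: "k \<noteq> n" for k
  proof
    assume close: "\<eta> k - \<eta> n \<in> lattice (1 - int k)"
    have large: "\<eta> k \<notin> lattice (1 - int k)"
      using \<eta>[of k] lattice_antimono[of "- 2 * int k" "1 - int k"] by auto
    consider "k < n" | "n < k" using kn by linarith
    then show False
    proof cases
      case 1
      then obtain t where t: "\<eta> k \<in> lattice t" "\<eta> n \<notin> lattice t" using lacunary by blast
      have "t \<le> 1 - int k"
        using large t(1) lattice_antimono[of "1 - int k" t] by force
      then have "\<eta> k - (\<eta> k - \<eta> n) \<in> lattice t"
        by (rule lattice_diff[OF t(1) lattice_antimono[OF _ close]])
      then show False using t by simp
    next
      case 2
      then obtain t where t: "\<eta> n \<in> lattice t" "\<eta> k \<notin> lattice t" using lacunary by blast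
      have "\<eta> k - \<eta> n + \<eta> n \<in> lattice (min t (1 - int k))"
        by (rule lattice_add[OF lattice_antimono[OF min.cobounded2 close] lattice_antimono[OF min.cobounded1 t(1)]])
      then have "\<eta> k \<in> lattice (min t (1 - int k))" by simp
      then show False using t(2) large by (cases "t \<le> 1 - int k") (auto simp: min_def)
    qed
  qed
  have "packet \<psi> k (y k) (\<eta> k - \<eta> n) \<phi> = (if k = n then 1 else 0)" for k
  proof -
    consider "k = n" | "k \<noteq> n" "A \<le> k" | "k < A" using n(1) by linarith
    then show ?thesis
    proof cases
      case 1
      have "\<phi> (y n + r) = 1" if "r \<in> lattice (int n)" for r
      proof -
        have "y n - x0 + r \<in> lattice (int A)"
          by (rule lattice_add[OF yn lattice_antimono[OF _ that]]) (use n(1) in simp)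
        then show ?thesis by (simp add: \<phi>_def algebra_simps)
      qed
      then have "packet \<psi> n (y n) 0 \<phi> = 1"
        by (intro packet_local[OF K]) (simp add: pairing_simps admissible_character_simps[OF \<psi>])
      then show ?thesis using 1 by simp
    next
      case 2
      then have "packet \<psi> k (y k) (\<eta> k - \<eta> n) \<phi> = 0"
        using far by (intro packet_eq_0_if_oscillating[OF K \<psi> lattice_invariant_mono[OF \<phi>(3), of "int k"]]) auto
      then show ?thesis using 2 by simp
    next
      case 3
      have "\<eta> k - \<eta> n \<notin> lattice (1 - int A)"
      proof
        assume close: "\<eta> k - \<eta> n \<in> lattice (1 - int A)"
        have "\<eta> k \<in> lattice s" using s(2) 3 by simp
        then have "\<eta> k - (\<eta> k - \<eta> n) \<in> lattice s"
          by (rule lattice_diff[OF _ lattice_antimono[OF s(1) close]])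
        then have "\<eta> n \<in> lattice (- 2 * int n)" using lattice_antimono[OF n(2)] by simp
        then show False using \<eta> by blast
      qed
      then have "packet \<psi> k (y k) (\<eta> k - \<eta> n) \<phi> = 0"
        using 3 by (intro packet_eq_0_if_oscillating[OF K \<psi> \<phi>(3)]) auto
      then show ?thesis using 3 n(1) by simp
    qed
  qed
  then have "fourier \<psi> \<phi> (packet_sum \<psi> y \<eta>) (\<eta> n) = (\<Sum>k. if k = n then 1 else 0)"
    by (simp only: fourier_packet_sum[OF \<psi>])
  also have "\<dots> = 1"
    using sums_unique[OF sums_single[of n "\<lambda>_. 1::complex"]] by simp
  finally show False using zero by simp
qed

section \<open>Choosing positions and frequencies\<close>

text \<open>
  Two powers of the uniformizer lie in the same coset of \<open>\<Lambda>\<close>, so \<open>\<Lambda>\<close> contains an element of nonzero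
  valuation; its powers are unbounded.
\<close>

lemma finite_index_subgroup_unbounded:
  fixes \<Lambda> :: "'k::discretely_valued_field set"
  assumes "open_finite_index_subgroup \<Lambda>"
  shows "\<exists>l\<in>\<Lambda>. ord_K l < N"
proof -
  have \<Lambda>: "1 \<in> \<Lambda>" "\<And>x y. x \<in> \<Lambda> \<Longrightarrow> y \<in> \<Lambda> \<Longrightarrow> x * y \<in> \<Lambda>" "0 \<notin> \<Lambda>"
    and fin: "finite {(\<lambda>x. c * x) ` \<Lambda> | c. c \<noteq> 0}"
    using assms by (auto simp: open_finite_index_subgroup_def)
  define coset where "coset n = (\<lambda>x. uniformizer ^ n * x) ` \<Lambda>" for n
  have "range coset \<subseteq> {(\<lambda>x. c * x) ` \<Lambda> | c. c \<noteq> 0}"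
    unfolding coset_def by auto
  then have "finite (range coset)" using fin finite_subset by blast
  then have "\<not> inj coset" using finite_imageD by blast
  then obtain i j where "i \<noteq> j" "coset i = coset j" unfolding inj_def by blast
  then obtain i j where ij: "i < j" "coset i = coset j" by (metis linorder_neqE_nat)
  have "uniformizer ^ i * 1 \<in> coset i" using \<Lambda>(1) unfolding coset_def by blast
  then obtain l where l: "l \<in> \<Lambda>" "uniformizer ^ i = uniformizer ^ j * l"
    using ij unfolding coset_def by auto
  have l0: "l \<noteq> 0" using l \<Lambda> by blast
  have "int i = int j + ord_K l"
    using arg_cong[OF l(2), of ord_K] l0 by (simp add: ord_K_power ord_K_mult)
  then have neg: "ord_K l \<le> -1" using ij by linarith
  define k where "k = nat \<bar>N\<bar> + 1"
  have "l ^ k \<in> \<Lambda>" by (induction k) (use \<Lambda> l in auto)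
  have "int k * ord_K l \<le> int k * -1" using neg by (intro mult_left_mono) auto
  moreover have "ord_K (l ^ k) = int k * ord_K l" "int k * -1 < N"
    by (rule ord_K_power[OF l0]) (simp add: k_def)
  ultimately have "ord_K (l ^ k) < N" by linarith
  with \<open>l ^ k \<in> \<Lambda>\<close> show ?thesis by blast
qed

text \<open>
  There are countably many boxes of lattice cosets, because each lattice splits into finitely many
  cosets of a smaller one. One point of \<open>S\<close> from every box that meets \<open>S\<close> gives a countable dense
  subset. Decoding the index as a pair enumerates each of its points infinitely often.
\<close>

lemma dense_recurrent_sequence:
  fixes S :: "(('k::discretely_valued_field ^ 'd) \<times> ('k ^ 'd)) set"
  assumes K: "nonarch_local_field TYPE('k)" and "S \<noteq> {}"
  shows "\<exists>s. (\<forall>n. s n \<in> S) \<and> (\<forall>x \<xi> a b n0. (x, \<xi>) \<in> S \<longrightarrow>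
    (\<exists>n\<ge>n0::nat. fst (s n) - x \<in> lattice a \<and> snd (s n) - \<xi> \<in> lattice b))"
proof -
  obtain T :: "int \<Rightarrow> int \<Rightarrow> ('k ^ 'd) set"
    where T: "\<And>j k. finite (T j k)" "\<And>j k x. x \<in> lattice j \<Longrightarrow> \<exists>t\<in>T j k. x - t \<in> lattice k"
    using lattice_finite_representatives[OF K] by metis
  define G where "G = (\<Union>j k. T j k)"
  have "countable G" unfolding G_def using T(1) by (intro countable_UN countableI_type countable_finite)
  have G: "\<exists>t\<in>G. x - t \<in> lattice k" for x k
  proof -
    obtain j where "x \<in> lattice j" using mem_some_lattice by blast
    then obtain t where "t \<in> T j k" "x - t \<in> lattice k" using T(2)[of x j k] by blast
    then show ?thesis by (intro bexI[of _ t]) (auto simp: G_def)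
  qed
  define inbox where "inbox t t' k p \<longleftrightarrow> p \<in> S \<and> fst p - t \<in> lattice k \<and> snd p - t' \<in> lattice k" for t t' k p
  define D where "D = (\<lambda>(t, t', k). SOME p. inbox t t' k p) ` {(t, t', k). t \<in> G \<and> t' \<in> G \<and> (\<exists>p. inbox t t' k p)}"
  have "{(t, t', k). t \<in> G \<and> t' \<in> G \<and> (\<exists>p. inbox t t' k p)} \<subseteq> G \<times> G \<times> (UNIV :: int set)" by auto
  moreover have "countable (G \<times> G \<times> (UNIV :: int set))"
    using \<open>countable G\<close> by (intro countable_SIGMA countableI_type)
  ultimately have "countable D" unfolding D_def using countable_subset by (intro countable_image) blast
  have DS: "p \<in> S" if pD: "p \<in> D" for p
  proof -
    obtain t t' k where p: "p = (SOME p. inbox t t' k p)" and ex: "\<exists>p. inbox t t' k p"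
      using pD unfolding D_def by fast
    have "inbox t t' k p" unfolding p by (rule someI_ex[OF ex])
    then show ?thesis by (simp add: inbox_def)
  qed
  have dense: "\<exists>p\<in>D. fst p - x \<in> lattice k \<and> snd p - \<xi> \<in> lattice k" if "(x, \<xi>) \<in> S" for x \<xi> k
  proof -
    obtain t t' where t: "t \<in> G" "t' \<in> G" "x - t \<in> lattice k" "\<xi> - t' \<in> lattice k" using G by meson
    then have ex: "inbox t t' k (x, \<xi>)" using that by (simp add: inbox_def)
    define p where "p = (SOME p. inbox t t' k p)"
    have "inbox t t' k p" unfolding p_def by (rule someI[of "inbox t t' k", OF ex])
    then have "fst p - t \<in> lattice k" "snd p - t' \<in> lattice k" by (simp_all add: inbox_def)
    from lattice_diff[OF this(1) t(3)] lattice_diff[OF this(2) t(4)]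
    have "fst p - x \<in> lattice k" "snd p - \<xi> \<in> lattice k" by simp_all
    moreover have "p \<in> D"
      unfolding D_def by (rule image_eqI[of _ _ "(t, t', k)"]) (use t ex in \<open>auto simp: p_def\<close>)
    ultimately show ?thesis by blast
  qed
  have "D \<noteq> {}" using dense \<open>S \<noteq> {}\<close> by fast
  define s where "s n = from_nat_into D (fst (prod_decode n))" for n
  have "s n \<in> S" for n unfolding s_def using DS from_nat_into[OF \<open>D \<noteq> {}\<close>] by blast
  moreover have "\<exists>n\<ge>n0. fst (s n) - x \<in> lattice a \<and> snd (s n) - \<xi> \<in> lattice b" if S: "(x, \<xi>) \<in> S" for x \<xi> a b n0
  proof -
    obtain p where p: "p \<in> D" "fst p - x \<in> lattice (max a b)" "snd p - \<xi> \<in> lattice (max a b)"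
      using dense[OF S] by blast
    define n where "n = prod_encode (to_nat_on D p, n0)"
    have "s n = p" using p(1) \<open>countable D\<close> by (simp add: s_def n_def)
    moreover have "n0 \<le> n" unfolding n_def by (rule le_prod_encode_2)
    ultimately show ?thesis
      using lattice_antimono[OF max.cobounded1 p(2)] lattice_antimono[OF max.cobounded2 p(3)] by blast
  qed
  ultimately show ?thesis by blast
qed

text \<open>
  Multiplying by large elements of \<open>\<Lambda>\<close> moves a nonzero vector out of any lattice. The choice is made
  recursively together with an integer \<open>t n\<close> such that the vectors chosen so far lie in \<open>lattice (t n)\<close>;
  the next vector is required to leave that lattice.
\<close>

lemma lacunary_multipliers:
  fixes \<zeta> :: "nat \<Rightarrow> 'k::discretely_valued_field ^ 'd"
  assumes \<Lambda>: "open_finite_index_subgroup \<Lambda>" and nz: "\<And>n. \<zeta> n \<noteq> 0"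
  shows "\<exists>l. \<forall>n. l n \<in> \<Lambda> \<and> l n *s \<zeta> n \<notin> lattice (- 2 * int n) \<and>
    (\<forall>k<n. \<exists>t. l k *s \<zeta> k \<in> lattice t \<and> l n *s \<zeta> n \<notin> lattice t)"
proof -
  have escape: "\<exists>l\<in>\<Lambda>. l *s \<zeta> n \<notin> lattice c" for n c
  proof -
    obtain b where b: "\<zeta> n \<notin> lattice b" using not_mem_some_lattice[OF nz] by blast
    obtain l where l: "l \<in> \<Lambda>" "ord_K l < c - b" using finite_index_subgroup_unbounded[OF \<Lambda>] by blast
    have "l \<noteq> 0" using l \<Lambda> by (auto simp: open_finite_index_subgroup_def)
    then have "l *s \<zeta> n \<notin> lattice c"
      using b l(2) lattice_antimono[of b "c - ord_K l" "\<zeta> n"] by (auto simp: lattice_scale)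
    then show ?thesis using l by blast
  qed
  let ?P = "\<lambda>n (l, t). l \<in> \<Lambda> \<and> l *s \<zeta> n \<in> lattice t \<and> l *s \<zeta> n \<notin> lattice (- 2 * int n)"
  let ?Q = "\<lambda>n (l, t) (l', t'). t' \<le> t \<and> l' *s \<zeta> (Suc n) \<notin> lattice t"
  have "\<exists>f. \<forall>n. ?P n (f n) \<and> ?Q n (f n) (f (Suc n))"
  proof (rule dependent_nat_choice)
    obtain l where "l \<in> \<Lambda>" "l *s \<zeta> 0 \<notin> lattice (- 2 * int 0)" using escape by blast
    moreover obtain t where "l *s \<zeta> 0 \<in> lattice t" using mem_some_lattice by blast
    ultimately show "\<exists>x. ?P 0 x" by blast
  next
    fix x n assume "?P n x"
    obtain l t where x: "x = (l, t)" by fastforce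
    obtain l' where l': "l' \<in> \<Lambda>" "l' *s \<zeta> (Suc n) \<notin> lattice (min t (- 2 * int (Suc n)))"
      using escape by blast
    moreover obtain t' where "t' \<le> t" "l' *s \<zeta> (Suc n) \<in> lattice t'" using mem_some_lattice by blast
    moreover have "l' *s \<zeta> (Suc n) \<notin> lattice t" "l' *s \<zeta> (Suc n) \<notin> lattice (- 2 * int (Suc n))"
      using l'(2) lattice_antimono[OF min.cobounded1] lattice_antimono[OF min.cobounded2] by blast+
    ultimately show "\<exists>x'. ?P (Suc n) x' \<and> ?Q n x x'"
      by (intro exI[of _ "(l', t')"]) (simp add: x)
  qed
  then obtain f where f: "\<And>n. ?P n (f n) \<and> ?Q n (f n) (f (Suc n))" by blast
  define l t where "l n = fst (f n)" and "t n = snd (f n)" for n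
  have P: "l n \<in> \<Lambda>" "l n *s \<zeta> n \<in> lattice (t n)" "l n *s \<zeta> n \<notin> lattice (- 2 * int n)" for n
    using f[of n] by (simp_all add: l_def t_def case_prod_unfold)
  have Q: "t (Suc n) \<le> t n" "l (Suc n) *s \<zeta> (Suc n) \<notin> lattice (t n)" for n
    using f[of n] by (simp_all add: l_def t_def case_prod_unfold)
  have "l n *s \<zeta> n \<notin> lattice (t k)" if kn: "k < n" for k n
  proof -
    obtain n' where n': "n = Suc n'" "k \<le> n'" using kn by (cases n) auto
    have "t n' \<le> t k" using lift_Suc_antimono_le[of t] Q(1) n'(2) by blast
    then show ?thesis using Q(2)[of n'] lattice_antimono n'(1) by blast
  qed
  then show ?thesis using P by blast
qed

lemma closed_set_misses_coset_box:
  fixes S :: "(('k::discretely_valued_field ^ 'd) \<times> ('k ^ 'd)) set"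
  assumes S: "closedin (top_of_set (UNIV \<times> (UNIV - {0}))) S" and p: "(x0, \<xi>0) \<notin> S" "\<xi>0 \<noteq> 0"
  shows "\<exists>a b. \<xi>0 \<notin> lattice b \<and> (\<forall>x \<xi>. x - x0 \<in> lattice a \<longrightarrow> \<xi> - \<xi>0 \<in> lattice b \<longrightarrow> (x, \<xi>) \<notin> S)"
proof -
  obtain C where C: "closed C" "S = UNIV \<times> (UNIV - {0}) \<inter> C" using S unfolding closedin_closed by blast
  then have "open (- C)" "(x0, \<xi>0) \<in> - C" using p by auto
  then obtain A B where AB: "open A" "open B" "x0 \<in> A" "\<xi>0 \<in> B" "A \<times> B \<subseteq> - C"
    by (elim open_prod_elim) auto
  obtain a where a: "\<And>x. x - x0 \<in> lattice a \<Longrightarrow> x \<in> A"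
    using AB(1,3) unfolding open_iff_lattice by blast
  obtain b where b: "\<And>x. x - \<xi>0 \<in> lattice b \<Longrightarrow> x \<in> B"
    using AB(2,4) unfolding open_iff_lattice by blast
  obtain b' where b': "\<xi>0 \<notin> lattice b'" using not_mem_some_lattice[OF p(2)] by blast
  show ?thesis
  proof (rule exI[of _ a], rule exI[of _ "max b b'"], intro conjI allI impI)
    show "\<xi>0 \<notin> lattice (max b b')" using b' lattice_antimono[OF max.cobounded2] by blast
    fix x \<xi> assume "x - x0 \<in> lattice a" "\<xi> - \<xi>0 \<in> lattice (max b b')"
    then have "x \<in> A" "\<xi> \<in> B" using a b lattice_antimono[OF max.cobounded1] by blast+
    then show "(x, \<xi>) \<notin> S" using AB(5) C(2) by blast
  qed
qed

section \<open>Distributions with prescribed wave front set\<close>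

theorem theorem2p8p9:
  fixes \<psi> :: "'k::discretely_valued_field \<Rightarrow> complex"
    and \<Lambda> :: "'k set"
    and S :: "(('k ^ 'd) \<times> ('k ^ 'd)) set"
  assumes "nonarch_local_field TYPE('k)"
    and "admissible_character \<psi>"
    and "open_finite_index_subgroup \<Lambda>"
    and "closedin (top_of_set (UNIV \<times> (UNIV - {0}))) S"
    and "\<And>x \<xi> l. (x, \<xi>) \<in> S \<Longrightarrow> l \<in> \<Lambda> \<Longrightarrow> (x, l *s \<xi>) \<in> S"
  shows "\<exists>u \<in> distributions UNIV. wave_front_set \<psi> \<Lambda> UNIV u = S"
proof (cases "S = {}")
  case True
  have "smooth_at \<psi> \<Lambda> UNIV (\<lambda>_. 0) x \<xi>" for x \<xi> :: "'k ^ 'd"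
    unfolding smooth_at_def by (intro exI[of _ UNIV]) (simp add: fourier_def)
  then have "wave_front_set \<psi> \<Lambda> UNIV (\<lambda>_. 0) = S"
    using True by (simp add: wave_front_set_def)
  moreover have "(\<lambda>_. 0) \<in> distributions UNIV"
    by (simp add: distributions_def)
  ultimately show ?thesis by blast
next
  case False
  note K = assms(1) and \<psi> = assms(2) and \<Lambda> = assms(3) and cone = assms(5)
  have \<Lambda>': "\<And>l. l \<in> \<Lambda> \<Longrightarrow> inverse l \<in> \<Lambda>" "0 \<notin> \<Lambda>"
    using \<Lambda> by (auto simp: open_finite_index_subgroup_def)
  have nz: "\<xi> \<noteq> 0" if "(x, \<xi>) \<in> S" for x \<xi>
    using closedin_subset[OF assms(4)] that by auto
  obtain s where s: "\<And>n. s n \<in> S" and dense: "\<And>x \<xi> a b n0. (x, \<xi>) \<in> S \<Longrightarrow>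
      \<exists>n\<ge>n0::nat. fst (s n) - x \<in> lattice a \<and> snd (s n) - \<xi> \<in> lattice b"
    using dense_recurrent_sequence[OF K False] by blast
  have "snd (s n) \<noteq> 0" for n using nz[of "fst (s n)" "snd (s n)"] s by simp
  then obtain l where l: "\<And>n. l n \<in> \<Lambda>" "\<And>n. l n *s snd (s n) \<notin> lattice (- 2 * int n)"
    "\<And>k n. k < n \<Longrightarrow> \<exists>t. l k *s snd (s k) \<in> lattice t \<and> l n *s snd (s n) \<notin> lattice t"
    using lacunary_multipliers[OF \<Lambda>, of "\<lambda>n. snd (s n)"] by blast
  define y \<eta> where "y n = fst (s n)" and "\<eta> n = l n *s snd (s n)" for n
  have S: "(y n, \<eta> n) \<in> S" for n
    unfolding y_def \<eta>_def using s[of n] l(1)[of n] by (intro cone) simp_all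
  have \<eta>: "\<eta> n \<notin> lattice (- 2 * int n)" for n unfolding \<eta>_def by (rule l(2))
  let ?u = "packet_sum \<psi> y \<eta>"
  have "smooth_at \<psi> \<Lambda> UNIV ?u x \<xi> \<longleftrightarrow> (x, \<xi>) \<notin> S" if \<xi>: "\<xi> \<noteq> 0" for x \<xi>
  proof (cases "(x, \<xi>) \<in> S")
    case True
    have "\<exists>n\<ge>n0. y n - x \<in> lattice a \<and> (\<exists>l\<in>\<Lambda>. \<exists>\<zeta>. \<eta> n = l *s \<zeta> \<and> \<zeta> - \<xi> \<in> lattice b)" for a b n0
      using dense[OF True, of n0 a b] l(1) unfolding y_def \<eta>_def by blast
    moreover have "\<exists>t. \<eta> k \<in> lattice t \<and> \<eta> n \<notin> lattice t" if "k < n" for k n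
      unfolding \<eta>_def by (rule l(3)[OF that])
    ultimately have "\<not> smooth_at \<psi> \<Lambda> UNIV ?u x \<xi>"
      by (intro packet_sum_not_smooth_at_limit[OF K \<psi> \<Lambda>'(2) \<eta>])
    then show ?thesis using True by blast
  next
    case False
    obtain a b where b: "\<xi> \<notin> lattice b"
      and off: "\<And>x' \<xi>'. x' - x \<in> lattice a \<Longrightarrow> \<xi>' - \<xi> \<in> lattice b \<Longrightarrow> (x', \<xi>') \<notin> S"
      using closed_set_misses_coset_box[OF assms(4) False \<xi>] by blast
    have "smooth_at \<psi> \<Lambda> UNIV ?u x \<xi>"
      by (rule packet_sum_smooth_off_closed_cone[OF K \<psi> \<Lambda>' cone S \<eta> off b])
    then show ?thesis using False by blast
  qed
  then have "wave_front_set \<psi> \<Lambda> UNIV ?u = S"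
    using nz by (auto simp: wave_front_set_def)
  moreover have "?u \<in> distributions UNIV"
    by (rule packet_sum_distribution[OF K \<psi> \<eta>])
  ultimately show ?thesis by blast
qed

end
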